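(* Let $\mu$ be a good measure on $2^{\mathbb{N}}$ whose clopen values set $V_\mu$ is contained in $\mathbb{Q}$. The following conditions are equivalent: (1) $\mathrm{Homeo}(2^{\mathbb{N}},\mu)$ admits a dense conjugacy class. (2) $\mathrm{Homeo}(2^{\mathbb{N}},\mu)$ admits a comeager conjugacy class. (3) $V_\mu+\mathbb{Z}$ is a subring of $\mathbb{R}$.
   Context: All measures are Borel probability measures; $2^{\mathbb{N}}$ is the Cantor space. A measure is full if it is positive on every nonempty open set. $V_\mu=\{\mu(U): U\subseteq 2^{\mathbb{N}}\text{ clopen}\}$ is the clopen values set of $\mu$. A full measure $\mu$ on $2^{\mathbb{N}}$ is good if it satisfies the Subset Condition: whenever $U,V$ are clopen with $\mu(U)<\mu(V)$, there is a clopen $W\subseteq V$ with $\mu(W)=\mu(U)$ (such a measure is automatically nonatomic). $\mathrm{Homeo}(2^{\mathbb{N}},\mu)$ is the Polish group (with the compact-open topology) of homeomorphisms of $2^{\mathbb{N}}$ preserving $\mu$. $V_\mu+\mathbb{Z}=\{v+k: v\in V_\mu,\ k\in\mathbb{Z}\}$. *)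

theory Defs
  imports
    "HOL-Probability.Probability_Measure"
    "HOL-Algebra.Subrings"
    "HOL-Algebra.Algebraic_Closure_Type"
begin

text \<open>The Cantor space is the type \<open>nat \<Rightarrow> bool\<close>, whose library topology is the product of the
  discrete topologies on \<open>bool\<close>.\<close>

type_synonym cantor = "nat \<Rightarrow> bool"

definition clopen :: "'a::topological_space set \<Rightarrow> bool" where
  "clopen U \<longleftrightarrow> open U \<and> closed U"

definition borel_prob :: "'a::topological_space measure \<Rightarrow> bool" where
  "borel_prob M \<longleftrightarrow> prob_space M \<and> sets M = sets borel"

definition full_measure :: "'a::topological_space measure \<Rightarrow> bool" where
  "full_measure M \<longleftrightarrow> (\<forall>U. open U \<and> U \<noteq> {} \<longrightarrow> 0 < measure M U)"

definition subset_condition :: "'a::topological_space measure \<Rightarrow> bool" where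
  "subset_condition M \<longleftrightarrow>
     (\<forall>U V. clopen U \<and> clopen V \<and> measure M U < measure M V \<longrightarrow>
        (\<exists>W. clopen W \<and> W \<subseteq> V \<and> measure M W = measure M U))"

definition good_measure :: "cantor measure \<Rightarrow> bool" where
  "good_measure M \<longleftrightarrow> borel_prob M \<and> full_measure M \<and> subset_condition M"

definition clopen_values :: "'a::topological_space measure \<Rightarrow> real set" where
  "clopen_values M = {measure M U | U. clopen U}"

definition plus_ints :: "real set \<Rightarrow> real set" where
  "plus_ints V = {v + real_of_int k | v k. v \<in> V}"


definition homeo_group :: "'a::topological_space measure \<Rightarrow> ('a \<Rightarrow> 'a) monoid" where
  "homeo_group M =
     \<lparr>carrier = {h. (\<exists>g. homeomorphism UNIV UNIV h g) \<and> distr M M h = M},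
      monoid.mult = (\<circ>), one = id\<rparr>"

text \<open>The compact-open topology on the set of continuous maps; taking \<open>K = {}\<close> shows that its
  carrier consists of all continuous maps.\<close>

definition compact_open_topology :: "('a::topological_space \<Rightarrow> 'b::topological_space) topology" where
  "compact_open_topology =
     topology_generated_by
       {{f. continuous_on UNIV f \<and> f ` K \<subseteq> U} | K U. compact K \<and> open U}"

definition homeo_topology :: "'a::topological_space measure \<Rightarrow> ('a \<Rightarrow> 'a) topology" where
  "homeo_topology M = subtopology compact_open_topology (carrier (homeo_group M))"


definition conjugacy_class :: "('g, 'm) monoid_scheme \<Rightarrow> 'g \<Rightarrow> 'g set" where
  "conjugacy_class G g = {x \<otimes>\<^bsub>G\<^esub> g \<otimes>\<^bsub>G\<^esub> inv\<^bsub>G\<^esub> x | x. x \<in> carrier G}"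

definition dense_in :: "'a topology \<Rightarrow> 'a set \<Rightarrow> bool" where
  "dense_in T S \<longleftrightarrow> S \<subseteq> topspace T \<and> Abstract_Topology.closure_of T S = topspace T"

definition nowhere_dense_in :: "'a topology \<Rightarrow> 'a set \<Rightarrow> bool" where
  "nowhere_dense_in T S \<longleftrightarrow>
     S \<subseteq> topspace T \<and> T interior_of (Abstract_Topology.closure_of T S) = {}"

definition meager_in :: "'a topology \<Rightarrow> 'a set \<Rightarrow> bool" where
  "meager_in T S \<longleftrightarrow> (\<exists>\<F>. countable \<F> \<and> (\<forall>N\<in>\<F>. nowhere_dense_in T N) \<and> S = \<Union>\<F>)"

definition comeager_in :: "'a topology \<Rightarrow> 'a set \<Rightarrow> bool" where
  "comeager_in T S \<longleftrightarrow> S \<subseteq> topspace T \<and> meager_in T (topspace T - S)"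


lemma topspace_compact_open_topology:
  "topspace (compact_open_topology :: ('a::topological_space \<Rightarrow> 'b::topological_space) topology)
     = {f. continuous_on UNIV f}"
proof -
  have "{f :: 'a \<Rightarrow> 'b. continuous_on UNIV f} =
      {f. continuous_on UNIV f \<and> f ` {} \<subseteq> (UNIV :: 'b set)}"
    by simp
  then have "{f :: 'a \<Rightarrow> 'b. continuous_on UNIV f} \<in>
      {{f. continuous_on UNIV f \<and> f ` K \<subseteq> U} | K U. compact K \<and> open U}"
    using compact_empty open_UNIV by blast
  then show ?thesis
    unfolding compact_open_topology_def topology_generated_by_topspace by blast
qed

lemma topspace_homeo_topology: "topspace (homeo_topology M) = carrier (homeo_group M)"
  by (auto simp: homeo_topology_def topspace_compact_open_topology homeo_group_def homeomorphism_def)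

lemma group_homeo_group:
  fixes M :: "'a::topological_space measure"
  assumes "borel_prob M"
  shows "group (homeo_group M)"
proof -
  have sets: "sets M = sets borel"
    using assms by (simp add: borel_prob_def)
  have meas: "h \<in> measurable M M" if "homeomorphism UNIV UNIV h g" for g h :: "'a \<Rightarrow> 'a"
    using that borel_measurable_continuous_onI[of h]
    by (simp add: homeomorphism_def measurable_cong_sets[OF sets sets])
  have comp: "distr M M (f \<circ> h) = M"
    if "homeomorphism UNIV UNIV f f'" "homeomorphism UNIV UNIV h h'"
       "distr M M f = M" "distr M M h = M" for f f' h h'
    using distr_distr[OF meas[OF that(1)] meas[OF that(2)]] that(3,4) by simp
  have inverse: "distr M M g = M" if "homeomorphism UNIV UNIV h g" "distr M M h = M" for g h
  proof -
    have "g \<circ> h = (\<lambda>x. x)"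
      using that(1) by (auto simp: homeomorphism_def)
    then show ?thesis
      using distr_distr[OF meas[OF homeomorphism_symD[OF that(1)]] meas[OF that(1)]] that(2)
      by (simp add: distr_id)
  qed
  show ?thesis
  proof (rule groupI)
    fix x y assume "x \<in> carrier (homeo_group M)" "y \<in> carrier (homeo_group M)"
    then show "x \<otimes>\<^bsub>homeo_group M\<^esub> y \<in> carrier (homeo_group M)"
      by (auto simp: homeo_group_def intro: homeomorphism_compose comp)
  next
    show "\<one>\<^bsub>homeo_group M\<^esub> \<in> carrier (homeo_group M)"
      by (auto simp: homeo_group_def id_def distr_id intro!: exI[of _ "\<lambda>x. x"] homeomorphism_ident)
  next
    fix x assume "x \<in> carrier (homeo_group M)"
    then obtain g where g: "homeomorphism UNIV UNIV x g" "distr M M x = M"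
      by (auto simp: homeo_group_def)
    moreover have "g \<circ> x = id"
      using g(1) by (auto simp: homeomorphism_def)
    ultimately show "\<exists>y\<in>carrier (homeo_group M). y \<otimes>\<^bsub>homeo_group M\<^esub> x = \<one>\<^bsub>homeo_group M\<^esub>"
      using inverse homeomorphism_symD[OF g(1)] by (auto simp: homeo_group_def)
  qed (auto simp: homeo_group_def)
qed

end

theory Submission
  imports Defs "HOL-Combinatorics.Permutations"
begin

text \<open>
  Let \<open>V\<close> be the clopen values set of \<open>\<mu>\<close>. If \<open>V + \<int>\<close> is not a ring, there are \<open>1/n\<close> and \<open>w\<close> in \<open>V\<close> with
  \<open>w/n\<close> not in \<open>V\<close>. An element of a dense class is conjugate to a homeomorphism permuting \<open>n\<close> clopen sets
  cyclically and to one fixing a clopen set \<open>B\<close> of measure \<open>w\<close>, since both conditions are open and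
  nonempty; but then \<open>B\<close> is cut into \<open>n\<close> clopen pieces of equal measure \<open>w/n\<close>, a contradiction.

  If \<open>V + \<int>\<close> is a ring, call a clopen partition uniform if its members have the same measure \<open>1/n\<close>.
  Since \<open>V\<close> is rational, homeomorphisms permuting arbitrarily fine uniform partitions are dense.
  A permutation of a uniform partition, together with two of its uniform extensions, amalgamates in the
  fibre product, whose atoms have measures in \<open>V\<close> because of the ring property. Hence the homeomorphisms
  realising every abstract uniform extension of their finite permutation actions form a dense
  \<open>G\<^sub>\<delta>\<close> set, and any two of them are conjugate by back and forth.
\<close>

subsection \<open>Locally constant labellings of the Cantor space\<close>

text \<open>Rationality enters through Bezout: \<open>V + \<int>\<close> is always a group, so a
  reduced value m/n forces 1/n into \<open>V\<close>. A product (m/n) v then lies in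
  \<open>V + \<int>\<close> as soon as v/n does, and the ring question becomes one of dividing
  values. For the other direction, the obstacle is that a measure-preserving map seldom permutes a
  given clopen partition. When all cells have equal mass, preserving measure becomes an equality of
  cardinalities, and equal cardinalities yield a permutation. Goodness is used as homogeneity:
  labellings with equal masses differ by a measure-preserving homeomorphism. Labellings replace
  partitions because coarsening is then composition \<open>r \<circ> \<phi>\<close> and an action on
  cells is an equation \<open>\<phi> \<circ> f = \<sigma> \<circ> \<phi>\<close>. Extensions mention
  only permutations of initial segments and a map between them. So they are countable in number, and
  one found in a homeomorphism can be demanded of another; this transfer drives the back and forth
  between generic maps.\<close>

text \<open>Continuity into the discrete topology, stated so that the type of labels carries no
  topology. By compactness a labelling has finite range, so it is a clopen partition with named
  cells.\<close>

definition loc_const :: "(cantor \<Rightarrow> 'l) \<Rightarrow> bool" where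
  "loc_const \<phi> \<longleftrightarrow> (\<forall>A. open (\<phi> -` A))"

definition cyl :: "nat \<Rightarrow> cantor \<Rightarrow> bool list" where
  "cyl n x = map x [0..<n]"

lemma cyl_eq_iff: "cyl n x = cyl n y \<longleftrightarrow> (\<forall>i<n. x i = y i)"
  by (auto simp: cyl_def)

lemma cyl_mono: "cyl n x = cyl n y \<Longrightarrow> m \<le> n \<Longrightarrow> cyl m x = cyl m y"
  by (auto simp: cyl_eq_iff)

lemma cyl_take: "m \<le> n \<Longrightarrow> cyl m x = take m (cyl n x)"
  by (simp add: cyl_def take_map)

lemma finite_range_cyl: "finite (range (cyl n))"
proof (rule finite_subset)
  show "range (cyl n) \<subseteq> {xs. set xs \<subseteq> UNIV \<and> length xs = n}"
    by (simp add: cyl_def image_subset_iff)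
  show "finite {xs :: bool list. set xs \<subseteq> UNIV \<and> length xs = n}"
    by (rule finite_lists_length_eq) simp
qed

lemma cyl_separates: "(\<And>n. cyl n x = cyl n y) \<Longrightarrow> x = y"
proof
  fix i
  assume "\<And>n. cyl n x = cyl n y"
  from this[of "Suc i"] show "x i = y i"
    by (simp add: cyl_eq_iff)
qed

lemma clopen_iff_loc_const: "clopen (U :: cantor set) \<longleftrightarrow> loc_const (\<lambda>x. x \<in> U)"
proof
  assume U: "clopen U"
  have "(\<lambda>x. x \<in> U) -` A = (if True \<in> A then U else {}) \<union> (if False \<in> A then - U else {})" for A
  proof (rule Set.set_eqI)
    fix x
    show "x \<in> (\<lambda>x. x \<in> U) -` A \<longleftrightarrow>
        x \<in> (if True \<in> A then U else {}) \<union> (if False \<in> A then - U else {})"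
      by (cases "x \<in> U") simp_all
  qed
  then show "loc_const (\<lambda>x. x \<in> U)"
    unfolding loc_const_def using U by (auto simp: clopen_def closed_def)
next
  assume "loc_const (\<lambda>x. x \<in> U)"
  then have "open ((\<lambda>x. x \<in> U) -` {True})" "open ((\<lambda>x. x \<in> U) -` {False})"
    unfolding loc_const_def by blast+
  then show "clopen U"
    by (simp add: clopen_def closed_def vimage_def Compl_eq)
qed

lemma loc_const_clopen: "loc_const \<phi> \<Longrightarrow> clopen (\<phi> -` A)"
  unfolding loc_const_def clopen_def closed_def by (metis vimage_Compl)

lemma loc_const_comp: "loc_const \<phi> \<Longrightarrow> loc_const (\<lambda>x. r (\<phi> x))"
  unfolding loc_const_def
proof
  fix A
  assume "\<forall>A. open (\<phi> -` A)"
  moreover have "(\<lambda>x. r (\<phi> x)) -` A = \<phi> -` (r -` A)"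
    by auto
  ultimately show "open ((\<lambda>x. r (\<phi> x)) -` A)"
    by simp
qed

lemma loc_const_cyl: "loc_const (cyl n)"
  unfolding loc_const_def
proof
  fix A
  have 1: "open {y :: cantor. cyl n y = l}" for l
  proof (cases "length l = n")
    case True
    then have "{y :: cantor. cyl n y = l} = {y. \<forall>i\<in>{..<n}. y (id i) \<in> {nth l i}}"
      by (auto simp: cyl_def list_eq_iff_nth_eq)
    then show ?thesis
      using product_topology_basis'[of "{..<n}" "\<lambda>i. {nth l i}" id] by (simp add: open_discrete)
  next
    case False
    then have "{y. cyl n y = l} = {}"
      by (auto simp: cyl_def)
    then show ?thesis by simp
  qed
  have "cyl n -` A = (\<Union>l\<in>A. {y. cyl n y = l})"
    by auto
  then show "open (cyl n -` A)"
    using 1 by auto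
qed

lemma open_cyl_nhd:
  assumes "open (U :: cantor set)" "x \<in> U"
  shows "\<exists>n. \<forall>y. cyl n y = cyl n x \<longrightarrow> y \<in> U"
proof -
  have "openin (product_topology (\<lambda>i. euclidean) UNIV) U"
    using assms(1) by (simp add: open_fun_def)
  from product_topology_open_contains_basis[OF this assms(2)] obtain Y where
    Y: "x \<in> PiE UNIV Y" "finite {i. Y i \<noteq> UNIV}" "PiE UNIV Y \<subseteq> U"
    by auto
  obtain n where n: "\<And>i. Y i \<noteq> UNIV \<Longrightarrow> i < n"
    using Y(2) finite_nat_set_iff_bounded by auto
  have "y \<in> U" if "cyl n y = cyl n x" for y
  proof -
    have "y i \<in> Y i" for i
      using Y(1) n[of i] that by (cases "Y i = UNIV") (auto simp: cyl_eq_iff PiE_iff)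
    then show ?thesis using Y(3) by auto
  qed
  then show ?thesis by blast
qed

lemma compact_cantor: "compact (UNIV :: cantor set)"
proof -
  have "compact_space (euclidean :: bool topology)"
    by (simp add: compact_space_def finite_imp_compact)
  then have "compact_space (product_topology (\<lambda>_::nat. euclidean :: bool topology) UNIV)"
    by (simp add: compact_space_product_topology)
  then show ?thesis
    by (simp add: euclidean_product_topology compact_space_def)
qed

lemma closed_compact_cantor: "closed (K :: cantor set) \<Longrightarrow> compact K"
  using closed_Int_compact[OF _ compact_cantor] by simp

text \<open>As with a Lebesgue number, finitely many cylinders around points of \<open>K\<close>
  cover it, and the greatest of their depths serves at every point.\<close>

lemma compact_cyl_nhd:
  assumes "compact K" "open (U :: cantor set)" "K \<subseteq> U"
  shows "\<exists>n. \<forall>x\<in>K. \<forall>y. cyl n y = cyl n x \<longrightarrow> y \<in> U"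
proof -
  obtain N where N: "\<And>x y. x \<in> K \<Longrightarrow> cyl (N x) y = cyl (N x) x \<Longrightarrow> y \<in> U"
    using open_cyl_nhd[OF assms(2)] assms(3) by (metis subsetD)
  have "open {y. cyl (N x) y = cyl (N x) x}" for x
    using loc_const_cyl[of "N x", unfolded loc_const_def, rule_format, of "{cyl (N x) x}"]
    by (simp add: vimage_def)
  then obtain D where D: "D \<subseteq> K" "finite D" "K \<subseteq> (\<Union>x\<in>D. {y. cyl (N x) y = cyl (N x) x})"
    using compactE_image[OF assms(1), of K "\<lambda>x. {y. cyl (N x) y = cyl (N x) x}"] by auto
  \<comment> \<open>Inserting 0 keeps the set nonempty when \<open>K\<close>, and with it
    \<open>D\<close>, is empty.\<close>
  define n where "n = Max (insert 0 (N ` D))"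
  have n: "x \<in> D \<Longrightarrow> N x \<le> n" for x
    using D by (simp add: n_def)
  have "y \<in> U" if "x \<in> K" "cyl n y = cyl n x" for x y
    using D that N n by (smt (verit, best) UN_iff cyl_mono mem_Collect_eq subsetD)
  then show ?thesis by blast
qed

text \<open>Compactness again bounds the depth: each point shares a cylinder with some centre
  \<open>z\<close>, and agreement to depth \<open>n\<close> keeps both points in that cylinder,
  where the label is constant.\<close>

lemma loc_const_factor:
  assumes "loc_const \<phi>"
  obtains n where "\<And>x y. cyl n x = cyl n y \<Longrightarrow> \<phi> x = \<phi> y"
proof -
  have "open (\<phi> -` {\<phi> x})" for x
    using assms by (simp add: loc_const_def)
  then obtain N where N: "\<And>x y. cyl (N x) y = cyl (N x) x \<Longrightarrow> \<phi> y = \<phi> x"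
    using open_cyl_nhd[of "\<phi> -` {\<phi> x}" x for x] by (metis vimage_singleton_eq)
  have "open {y. cyl (N x) y = cyl (N x) x}" for x
    using loc_const_cyl[of "N x", unfolded loc_const_def, rule_format, of "{cyl (N x) x}"]
    by (simp add: vimage_def)
  then obtain D where D: "finite D" "UNIV \<subseteq> (\<Union>x\<in>D. {y. cyl (N x) y = cyl (N x) x})"
    using compactE_image[OF compact_cantor, of UNIV "\<lambda>x. {y. cyl (N x) y = cyl (N x) x}"] by auto
  define n where "n = Max (insert 0 (N ` D))"
  have n: "x \<in> D \<Longrightarrow> N x \<le> n" for x
    using D by (simp add: n_def)
  show thesis
  proof (rule that)
    fix x y assume xy: "cyl n x = cyl n y"
    obtain z where z: "z \<in> D" "cyl (N z) y = cyl (N z) z"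
      using D by blast
    then have "cyl (N z) x = cyl (N z) z"
      using xy n cyl_mono by metis
    then show "\<phi> x = \<phi> y"
      using z N by metis
  qed
qed

lemma loc_const_iff_cyl: "loc_const \<phi> \<longleftrightarrow> (\<exists>n s. \<phi> = s \<circ> cyl n)"
proof
  assume "loc_const \<phi>"
  then obtain n where n: "\<And>x y. cyl n x = cyl n y \<Longrightarrow> \<phi> x = \<phi> y"
    using loc_const_factor by blast
  \<comment> \<open>The decoding picks any point of the cylinder; the label does not depend on the
    choice.\<close>
  have "\<phi> = (\<lambda>l. \<phi> (SOME x. cyl n x = l)) \<circ> cyl n"
  proof
    fix x
    have "cyl n (SOME y. cyl n y = cyl n x) = cyl n x"
      by (rule someI[where x = x]) (rule refl)
    then show "\<phi> x = ((\<lambda>l. \<phi> (SOME x. cyl n x = l)) \<circ> cyl n) x"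
      using n[of x "SOME y. cyl n y = cyl n x"] by simp
  qed
  then show "\<exists>n s. \<phi> = s \<circ> cyl n" by blast
next
  assume "\<exists>n s. \<phi> = s \<circ> cyl n"
  then obtain n s where "\<phi> = (\<lambda>x. s (cyl n x))"
    by (auto simp: comp_def)
  then show "loc_const \<phi>"
    by (simp add: loc_const_comp[OF loc_const_cyl])
qed

lemma loc_const_finite: "loc_const \<phi> \<Longrightarrow> finite (range \<phi>)"
proof -
  assume "loc_const \<phi>"
  then obtain n s where "\<phi> = s \<circ> cyl n"
    unfolding loc_const_iff_cyl by (elim exE)
  then have "range \<phi> = s ` range (cyl n)"
    by (simp only: image_comp)
  then show ?thesis
    by (simp only: finite_imageI finite_range_cyl)
qed

lemma loc_const_Pair:
  assumes "loc_const \<phi>" "loc_const \<psi>"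
  shows "loc_const (\<lambda>x. (\<phi> x, \<psi> x))"
proof -
  have "(\<lambda>x. (\<phi> x, \<psi> x)) -` A = (\<Union>(a, b)\<in>A. \<phi> -` {a} \<inter> \<psi> -` {b})" for A
    by auto
  then show ?thesis
    using assms by (auto simp: loc_const_def intro!: open_UN open_Int)
qed

lemma loc_const_glue:
  assumes "loc_const \<phi>" "\<And>i. loc_const (\<delta> i)"
  shows "loc_const (\<lambda>x. \<delta> (\<phi> x) x)"
proof -
  have "(\<lambda>x. \<delta> (\<phi> x) x) -` A = (\<Union>i. \<phi> -` {i} \<inter> \<delta> i -` A)" for A
    by auto
  then show ?thesis
    using assms by (auto simp: loc_const_def intro!: open_UN open_Int)
qed

lemma loc_const_continuous:
  assumes "loc_const \<phi>" "continuous_on UNIV h"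
  shows "loc_const (\<lambda>x. \<phi> (h x))"
proof -
  have "(\<lambda>x. \<phi> (h x)) -` A = h -` (\<phi> -` A)" for A
    by auto
  then show ?thesis
    using assms continuous_on_open_vimage[OF open_UNIV, of h] by (simp add: loc_const_def)
qed

lemma loc_const_const: "loc_const (\<lambda>_. c)"
  by (simp add: loc_const_def vimage_def)

lemma continuous_cantorI:
  fixes h :: "cantor \<Rightarrow> cantor"
  assumes "\<And>n. loc_const (\<lambda>x. cyl n (h x))"
  shows "continuous_on UNIV h"
proof -
  have "open (h -` U)" if U: "open U" for U
  proof (subst open_subopen, rule ballI)
    fix x assume "x \<in> h -` U"
    then have "h x \<in> U"
      by simp
    then obtain n where n: "\<And>y. cyl n y = cyl n (h x) \<Longrightarrow> y \<in> U"
      using open_cyl_nhd[OF U] by blast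
    show "\<exists>T. open T \<and> x \<in> T \<and> T \<subseteq> h -` U"
      using assms[of n, unfolded loc_const_def, rule_format, of "{cyl n (h x)}"] n
      by (intro exI[of _ "(\<lambda>x. cyl n (h x)) -` {cyl n (h x)}"]) auto
  qed
  then show ?thesis
    by (simp add: continuous_on_open_vimage)
qed

text \<open>A labelling has finite depth, so it is a function on the finite set
  \<open>range (cyl n)\<close>. Restricting the decoding to that set makes it extensional, and such
  functions into a countable type are countably many.\<close>

lemma countable_loc_const: "countable {\<phi> :: cantor \<Rightarrow> 'l::countable. loc_const \<phi>}"
proof -
  have "{\<phi> :: cantor \<Rightarrow> 'l. loc_const \<phi>} \<subseteq>
      (\<Union>n. (\<lambda>s. s \<circ> cyl n) ` (range (cyl n) \<rightarrow>\<^sub>E UNIV))"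
  proof
    fix \<phi> :: "cantor \<Rightarrow> 'l" assume "\<phi> \<in> {\<phi>. loc_const \<phi>}"
    then obtain n s where "\<phi> = s \<circ> cyl n"
      unfolding mem_Collect_eq loc_const_iff_cyl by (elim exE)
    moreover have "s \<circ> cyl n = restrict s (range (cyl n)) \<circ> cyl n"
      by (simp add: fun_eq_iff)
    ultimately have "\<phi> = restrict s (range (cyl n)) \<circ> cyl n"
      by (rule trans)
    then show "\<phi> \<in> (\<Union>n. (\<lambda>s. s \<circ> cyl n) ` (range (cyl n) \<rightarrow>\<^sub>E UNIV))"
      by (intro UN_I[OF UNIV_I] image_eqI[where x = "restrict s (range (cyl n))"]) (auto simp: PiE_def extensional_def)
  qed
  moreover have "countable (range (cyl n) \<rightarrow>\<^sub>E (UNIV :: 'l set))" for n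
    by (rule countable_PiE) (auto simp: finite_range_cyl)
  ultimately show ?thesis
    by (elim countable_subset) (intro countable_UN countable_image countableI_type)
qed

text \<open>The point \<open>h x\<close> lies in all the nested closed fibres of
  \<open>\<psi> k\<close> over \<open>\<phi> k x\<close>: equal ranges make each nonempty, and
  compactness does the same for their intersection. Exchanging the sequences gives \<open>g\<close>;
  separation makes the two maps mutually inverse and continuous.\<close>

lemma limit_homeomorphism:
  fixes \<phi> \<psi> :: "nat \<Rightarrow> cantor \<Rightarrow> 'l"
  assumes lc: "\<And>k. loc_const (\<phi> k)" "\<And>k. loc_const (\<psi> k)"
    and ran: "\<And>k. range (\<phi> k) = range (\<psi> k)"
    and ref: "\<And>k. \<exists>r. \<phi> k = r \<circ> \<phi> (Suc k) \<and> \<psi> k = r \<circ> \<psi> (Suc k)"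
    and sep: "\<And>n. \<exists>k s. cyl n = s \<circ> \<phi> k" "\<And>n. \<exists>k s. cyl n = s \<circ> \<psi> k"
  shows "\<exists>h g. homeomorphism UNIV UNIV h g \<and> (\<forall>k. \<psi> k \<circ> h = \<phi> k)"
proof -
  have ex: "\<exists>y. \<forall>k. q k y = p k x"
    if lq: "\<And>k. loc_const (q k)" and ran: "\<And>k. range (p k) = range (q k)"
      and ref: "\<And>k. \<exists>r. p k = r \<circ> p (Suc k) \<and> q k = r \<circ> q (Suc k)"
    for p q :: "nat \<Rightarrow> cantor \<Rightarrow> 'l" and x
  proof -
    define F where "F k = q k -` {p k x}" for k
    have closed: "closed (F k)" for k
      using loc_const_clopen[OF lq] by (simp add: F_def clopen_def)
    have "F (Suc k) \<subseteq> F k" for k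
      using ref[of k] by (auto simp: F_def)
    then have "decseq F"
      by (rule decseq_SucI)
    have ne: "F k \<noteq> {}" for k
    proof -
      have "p k x \<in> range (q k)"
        using ran[of k] by blast
      then show ?thesis
        by (auto simp: F_def)
    qed
    have "\<Inter>(range F) \<noteq> {}"
    proof -
      have "UNIV \<inter> (\<Inter>k\<in>I. F k) \<noteq> {}" if "finite I" for I
      proof -
        \<comment> \<open>The fibres decrease, so the one with the largest index lies in all the
          others.\<close>
        have "F (Max (insert 0 I)) \<subseteq> (\<Inter>k\<in>I. F k)"
          using that \<open>decseq F\<close>
          by (intro INT_greatest) (simp add: decseq_def)
        then show ?thesis
          using ne[of "Max (insert 0 I)"] by blast
      qed
      then show ?thesis
        using compact_imp_fip_image[OF compact_cantor, of UNIV F] closed by auto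
    qed
    then show ?thesis
      by (auto simp: F_def)
  qed
  obtain h where h: "\<And>k x. \<psi> k (h x) = \<phi> k x"
    using ex[of \<psi> \<phi>, OF lc(2) ran ref] by metis
  have ref': "\<exists>r. \<psi> k = r \<circ> \<psi> (Suc k) \<and> \<phi> k = r \<circ> \<phi> (Suc k)" for k
    using ref by metis
  obtain g where g: "\<And>k x. \<phi> k (g x) = \<psi> k x"
    using ex[of \<phi> \<psi>, OF lc(1) ran[symmetric] ref'] by metis
  have "g (h x) = x" for x
  proof (rule cyl_separates)
    fix n
    obtain k s where "cyl n = s \<circ> \<phi> k" using sep by blast
    then show "cyl n (g (h x)) = cyl n x" by (simp add: g h)
  qed
  moreover have "h (g x) = x" for x
  proof (rule cyl_separates)
    fix n
    obtain k s where "cyl n = s \<circ> \<psi> k" using sep by blast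
    then show "cyl n (h (g x)) = cyl n x" by (simp add: g h)
  qed
  moreover have "continuous_on UNIV h"
  proof (rule continuous_cantorI)
    fix n
    obtain k s where "cyl n = s \<circ> \<psi> k" using sep by blast
    then show "loc_const (\<lambda>x. cyl n (h x))"
      using loc_const_comp[OF lc(1), of s k] by (simp add: h)
  qed
  moreover have "continuous_on UNIV g"
  proof (rule continuous_cantorI)
    fix n
    obtain k s where "cyl n = s \<circ> \<phi> k" using sep by blast
    then show "loc_const (\<lambda>x. cyl n (g x))"
      using loc_const_comp[OF lc(2), of s k] by (simp add: g)
  qed
  ultimately have "homeomorphism UNIV UNIV h g"
    unfolding homeomorphism_def by (metis UNIV_I surjI)
  moreover have "\<forall>k. \<psi> k \<circ> h = \<phi> k"
    using h by (simp add: fun_eq_iff)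
  ultimately show ?thesis
    by blast
qed

subsection \<open>Homogeneity of good measures\<close>

lemma clopen_Int: "clopen U \<Longrightarrow> clopen W \<Longrightarrow> clopen (U \<inter> W)"
  by (auto simp: clopen_def)

lemma clopen_Diff: "clopen U \<Longrightarrow> clopen W \<Longrightarrow> clopen (U - W)"
  by (auto simp: clopen_def)

lemma clopen_UNIV: "clopen UNIV" and clopen_empty: "clopen {}"
  by (auto simp: clopen_def)

text \<open>Countability is the point: there are only countably many cylinders, so each open set is
  a countable union of clopen ones.\<close>

lemma sigma_sets_clopen: "sets (borel :: cantor measure) = sigma_sets UNIV (Collect clopen)"
proof -
  have "sigma_sets UNIV (Collect open) = sigma_sets UNIV (Collect clopen :: cantor set set)"
  proof (rule sigma_sets_eqI)
    fix U :: "cantor set" assume U: "U \<in> Collect open"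
    define C where "C = (\<Union>n. (\<lambda>l. cyl n -` {l}) ` {l \<in> range (cyl n). cyl n -` {l} \<subseteq> U})"
    have "countable C"
      unfolding C_def by (intro countable_UN countable_image) auto
    moreover have "C \<subseteq> Collect clopen"
      unfolding C_def using loc_const_clopen[OF loc_const_cyl] by blast
    moreover have "U \<subseteq> \<Union>C"
    proof
      fix x assume "x \<in> U"
      then obtain n where n: "\<And>y. cyl n y = cyl n x \<Longrightarrow> y \<in> U"
        using open_cyl_nhd[of U x] U by auto
      then have "cyl n -` {cyl n x} \<in> C"
        unfolding C_def by auto
      then show "x \<in> \<Union>C"
        by auto
    qed
    then have "U = \<Union>C"
      unfolding C_def by auto
    ultimately show "U \<in> sigma_sets UNIV (Collect clopen)"
      by (simp only:) (intro sigma_sets_UNION sigma_sets.Basic, auto)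
  next
    fix U :: "cantor set" assume "U \<in> Collect clopen"
    then show "U \<in> sigma_sets UNIV (Collect open)"
      by (intro sigma_sets.Basic) (simp add: clopen_def)
  qed
  then show ?thesis
    by (simp add: borel_def)
qed

text \<open>Alternating forward and backward steps makes both sequences of labellings separate
  points, which gives \<open>g \<circ> h = id\<close> on one side and
  \<open>h \<circ> g = id\<close> on the other. The relation \<open>S\<close> holds the finite
  information that must agree: masses in one use, permutation actions in another.\<close>

lemma back_and_forth:
  fixes S :: "(cantor \<Rightarrow> nat) \<Rightarrow> (cantor \<Rightarrow> nat) \<Rightarrow> bool"
  assumes S0: "S \<phi>0 \<psi>0"
    and lc: "\<And>\<phi> \<psi>. S \<phi> \<psi> \<Longrightarrow> loc_const \<phi> \<and> loc_const \<psi> \<and> range \<phi> = range \<psi>"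
    and forward: "\<And>\<phi> \<psi> n. S \<phi> \<psi> \<Longrightarrow>
      \<exists>\<phi>' \<psi>' r s. S \<phi>' \<psi>' \<and> \<phi> = r \<circ> \<phi>' \<and> \<psi> = r \<circ> \<psi>' \<and> cyl n = s \<circ> \<phi>'"
    and backward: "\<And>\<phi> \<psi> n. S \<phi> \<psi> \<Longrightarrow>
      \<exists>\<phi>' \<psi>' r s. S \<phi>' \<psi>' \<and> \<phi> = r \<circ> \<phi>' \<and> \<psi> = r \<circ> \<psi>' \<and> cyl n = s \<circ> \<psi>'"
  shows "\<exists>h g \<Phi> \<Psi>. homeomorphism UNIV UNIV h g \<and> (\<forall>k::nat. S (\<Phi> k) (\<Psi> k)) \<and> (\<forall>k. \<Psi> k \<circ> h = \<Phi> k) \<and>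
    \<Phi> 0 = \<phi>0 \<and> \<Psi> 0 = \<psi>0 \<and> (\<forall>n. \<exists>k s. cyl n = s \<circ> \<Psi> k)"
proof -
  \<comment> \<open>The clause for \<open>n = 0\<close> pins the first pair, so that the limit can
    be compared with \<open>\<phi>0\<close> and \<open>\<psi>0\<close>.\<close>
  define P where "P n p \<longleftrightarrow> S (fst p) (snd p) \<and> (n = 0 \<longrightarrow> p = (\<phi>0, \<psi>0))"
    for n :: nat and p :: "(cantor \<Rightarrow> nat) \<times> (cantor \<Rightarrow> nat)"
  define Q where "Q n p p' \<longleftrightarrow> (\<exists>r. fst p = r \<circ> fst p' \<and> snd p = r \<circ> snd p') \<and>
      (\<exists>s. cyl n = s \<circ> fst p') \<and> (\<exists>s. cyl n = s \<circ> snd p')"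
    for n :: nat and p p' :: "(cantor \<Rightarrow> nat) \<times> (cantor \<Rightarrow> nat)"
  have "\<exists>f. \<forall>n. P n (f n) \<and> Q n (f n) (f (Suc n))"
  proof (rule dependent_nat_choice)
    show "\<exists>x. P 0 x"
      using S0 by (auto simp: P_def)
    fix p n assume "P n p"
    then have "S (fst p) (snd p)"
      by (simp add: P_def)
    from forward[OF this, of n] obtain \<phi>1 \<psi>1 r s where
      1: "S \<phi>1 \<psi>1" "fst p = r \<circ> \<phi>1" "snd p = r \<circ> \<psi>1" "cyl n = s \<circ> \<phi>1"
      by (elim exE conjE)
    from backward[OF 1(1), of n] obtain \<phi>2 \<psi>2 r' s' where
      2: "S \<phi>2 \<psi>2" "\<phi>1 = r' \<circ> \<phi>2" "\<psi>1 = r' \<circ> \<psi>2" "cyl n = s' \<circ> \<psi>2"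
      by (elim exE conjE)
    have "fst p = (r \<circ> r') \<circ> \<phi>2" "snd p = (r \<circ> r') \<circ> \<psi>2" "cyl n = (s \<circ> r') \<circ> \<phi>2"
      using 1(2-4) unfolding 2(2,3) by (simp_all only: comp_assoc)
    then have "Q n p (\<phi>2, \<psi>2)"
      unfolding Q_def fst_conv snd_conv using 2(4) by (intro conjI exI)
    then show "\<exists>y. P (Suc n) y \<and> Q n p y"
      using 2(1) by (intro exI[of _ "(\<phi>2, \<psi>2)"]) (simp add: P_def)
  qed
  then obtain f where f: "\<And>n. P n (f n)" "\<And>n. Q n (f n) (f (Suc n))"
    by blast
  have S: "S (fst (f k)) (snd (f k))" for k
    using f(1)[of k] by (simp add: P_def)
  have sep: "\<exists>k s. cyl n = s \<circ> fst (f k)" "\<exists>k s. cyl n = s \<circ> snd (f k)" for n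
  proof -
    from f(2)[of n] obtain s s' where s: "cyl n = s \<circ> fst (f (Suc n))" "cyl n = s' \<circ> snd (f (Suc n))"
      unfolding Q_def by (elim conjE exE)
    show "\<exists>k s. cyl n = s \<circ> fst (f k)"
      by (rule exI[of _ "Suc n"], rule exI[of _ s], rule s(1))
    show "\<exists>k s. cyl n = s \<circ> snd (f k)"
      by (rule exI[of _ "Suc n"], rule exI[of _ s'], rule s(2))
  qed
  have ref: "\<exists>r. fst (f k) = r \<circ> fst (f (Suc k)) \<and> snd (f k) = r \<circ> snd (f (Suc k))" for k
    using f(2)[of k] unfolding Q_def by (elim conjE)
  have "\<exists>h g. homeomorphism UNIV UNIV h g \<and> (\<forall>k. snd (f k) \<circ> h = fst (f k))"
  proof (rule limit_homeomorphism)
    show "loc_const (fst (f k))" "loc_const (snd (f k))" "range (fst (f k)) = range (snd (f k))" for k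
      using lc[OF S] by blast+
  qed (rule ref sep)+
  then obtain h g where h: "homeomorphism UNIV UNIV h g" "\<forall>k. snd (f k) \<circ> h = fst (f k)"
    by blast
  have "fst (f 0) = \<phi>0" "snd (f 0) = \<psi>0"
    using f(1)[of 0] by (simp_all add: P_def)
  then have "homeomorphism UNIV UNIV h g \<and> (\<forall>k. S (fst (f k)) (snd (f k))) \<and>
      (\<forall>k. snd (f k) \<circ> h = fst (f k)) \<and> fst (f 0) = \<phi>0 \<and> snd (f 0) = \<psi>0 \<and>
      (\<forall>n. \<exists>k s. cyl n = s \<circ> snd (f k))"
    by (intro conjI allI h S sep(2) h(2)[rule_format])
  then show ?thesis
    by (intro exI)
qed

section \<open>Good measures and the masses of labellings\<close>

locale good_cantor =
  fixes M :: "cantor measure"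
  assumes good: "good_measure M"
begin

abbreviation "H \<equiv> carrier (homeo_group M)"

lemma sets_M: "sets M = sets borel"
  using good by (simp add: good_measure_def borel_prob_def)

lemma space_M: "space M = UNIV"
  using sets_eq_imp_space_eq[OF sets_M] by simp

sublocale prob_space M
  using good by (simp add: good_measure_def borel_prob_def)

lemma clopen_measurable: "clopen U \<Longrightarrow> U \<in> sets M"
  by (simp add: sets_M clopen_def)

lemma prob_UNIV: "prob UNIV = 1"
  using prob_space space_M by simp

lemma clopen_null: "clopen U \<Longrightarrow> prob U = 0 \<Longrightarrow> U = {}"
  using good unfolding good_measure_def full_measure_def clopen_def by (metis less_irrefl)

lemma clopen_subset:
  assumes "clopen U" "clopen W" "prob U \<le> prob W"
  shows "\<exists>W'. clopen W' \<and> W' \<subseteq> W \<and> prob W' = prob U"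
proof (cases "prob U = prob W")
  case True
  then show ?thesis using assms by (intro exI[of _ W]) simp
next
  case False
  then show ?thesis
    using assms good unfolding good_measure_def subset_condition_def by (metis less_le)
qed

lemma carrier_cont: "h \<in> H \<Longrightarrow> continuous_on UNIV h"
  by (auto simp: homeo_group_def homeomorphism_def)

lemma carrier_loc_const: "h \<in> H \<Longrightarrow> loc_const \<phi> \<Longrightarrow> loc_const (\<lambda>x. \<phi> (h x))"
  using loc_const_continuous carrier_cont by blast

lemma carrier_prob:
  assumes "h \<in> H" "clopen U"
  shows "prob (h -` U) = prob U"
proof -
  have "h \<in> measurable M M"
    using borel_measurable_continuous_onI[OF carrier_cont[OF assms(1)]]
    by (simp add: measurable_cong_sets[OF sets_M sets_M])
  then have "measure (distr M M h) U = prob (h -` U)"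
    using clopen_measurable[OF assms(2)] by (simp add: measure_distr space_M)
  then show ?thesis
    using assms(1) by (simp add: homeo_group_def)
qed

text \<open>Clopen sets form an intersection-stable generator of the Borel sets, and finite measures
  agreeing on one coincide.\<close>

lemma carrierI:
  assumes h: "homeomorphism UNIV UNIV h g"
    and "\<And>U. clopen U \<Longrightarrow> prob (h -` U) = prob U"
  shows "h \<in> H"
proof -
  have cont: "continuous_on UNIV h"
    using h by (simp add: homeomorphism_def)
  have meas: "h \<in> measurable M M"
    using borel_measurable_continuous_onI[OF cont]
    by (simp add: measurable_cong_sets[OF sets_M sets_M])
  have "distr M M h = M"
  proof (rule measure_eqI_generator_eq[where E = "Collect clopen" and \<Omega> = UNIV and A = "\<lambda>_. UNIV"])
    show "Int_stable (Collect clopen :: cantor set set)"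
      by (auto simp: Int_stable_def clopen_Int)
    show "sets (distr M M h) = sigma_sets UNIV (Collect clopen)" "sets M = sigma_sets UNIV (Collect clopen)"
      using sets_M sigma_sets_clopen by simp_all
    fix U :: "cantor set" assume "U \<in> Collect clopen"
    then show "emeasure (distr M M h) U = emeasure M U"
      using meas assms(2) clopen_measurable
      by (simp add: emeasure_distr space_M emeasure_eq_measure)
  next
    show "emeasure (distr M M h) (UNIV :: cantor set) \<noteq> \<infinity>"
      using meas clopen_measurable[OF clopen_UNIV] by (simp add: emeasure_distr)
  qed (auto simp: clopen_UNIV)
  then show ?thesis
    using h by (auto simp: homeo_group_def)
qed

lemma loc_const_measurable: "loc_const \<phi> \<Longrightarrow> \<phi> -` A \<in> sets M"
  using loc_const_clopen clopen_measurable by blast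

lemma prob_label:
  assumes "loc_const \<phi>" "finite I" "range \<phi> \<subseteq> I"
  shows "prob (\<phi> -` A) = (\<Sum>i\<in>I \<inter> A. prob (\<phi> -` {i}))"
proof -
  have "\<phi> -` A = (\<Union>i\<in>I \<inter> A. \<phi> -` {i})"
    using assms(3) by auto
  also have "prob \<dots> = (\<Sum>i\<in>I \<inter> A. prob (\<phi> -` {i}))"
    by (rule finite_measure_finite_Union)
      (use assms in \<open>auto simp: loc_const_measurable disjoint_family_on_def\<close>)
  finally show ?thesis .
qed

text \<open>Fullness forbids null cells, so the masses alone determine which labels occur.\<close>

lemma label_range_iff:
  assumes "loc_const \<phi>"
  shows "i \<in> range \<phi> \<longleftrightarrow> prob (\<phi> -` {i}) \<noteq> 0"
proof -
  have "i \<in> range \<phi> \<longleftrightarrow> \<phi> -` {i} \<noteq> {}"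
    by auto
  then show ?thesis
    using clopen_null[OF loc_const_clopen[OF assms, of "{i}"]] by auto
qed

lemma same_masses_range:
  assumes "loc_const \<phi>" "loc_const \<psi>" "\<And>i. prob (\<phi> -` {i}) = prob (\<psi> -` {i})"
  shows "range \<phi> = range \<psi>"
  by (rule Set.set_eqI) (simp only: label_range_iff[OF assms(1)] label_range_iff[OF assms(2)] assms(3))

lemma same_masses:
  assumes "loc_const \<phi>" "loc_const \<psi>" "\<And>i. prob (\<phi> -` {i}) = prob (\<psi> -` {i})"
  shows "prob (\<phi> -` A) = prob (\<psi> -` A)"
  using prob_label[OF assms(1) loc_const_finite[OF assms(1)], of A]
    prob_label[OF assms(2) loc_const_finite[OF assms(2)], of A]
    same_masses_range[OF assms] assms(3) by simp

text \<open>Goodness lets the cells be carved out of \<open>B\<close> one at a time; each fits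
  because the remaining masses are nonnegative and add up to what is left of
  \<open>B\<close>.\<close>

lemma label_split:
  assumes "finite J" "clopen B" "\<And>j. j \<in> J \<Longrightarrow> w j \<in> clopen_values M" "sum w J = prob B"
  shows "\<exists>\<delta>. loc_const \<delta> \<and> (\<forall>x\<in>B. \<delta> x \<in> J) \<and> (\<forall>j\<in>J. prob (B \<inter> \<delta> -` {j}) = w j)"
  using assms
proof (induction J arbitrary: B)
  case empty
  \<comment> \<open>With no mass left, fullness leaves no points either, and a constant labelling
    will do.\<close>
  then have "B = {}"
    using clopen_null by simp
  then show ?case
    using loc_const_const[of undefined] by (intro exI[of _ "\<lambda>_. undefined"]) simp
next
  case (insert a J)
  have nn: "0 \<le> w j" if "j \<in> insert a J" for j
    using insert.prems(2)[OF that] by (auto simp: clopen_values_def)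
  have "w a \<le> prob B"
    using insert.prems(3) insert.hyps sum_nonneg[of J w] nn by auto
  moreover obtain U where "clopen U" "w a = prob U"
    using insert.prems(2)[of a] by (auto simp: clopen_values_def)
  ultimately obtain W where W: "clopen W" "W \<subseteq> B" "prob W = w a"
    using clopen_subset insert.prems(1) by metis
  have "prob (B - W) = prob B - prob W"
    using W insert.prems(1) by (intro finite_measure_Diff) (auto simp: clopen_measurable)
  then have "sum w J = prob (B - W)"
    using insert.prems(3) insert.hyps W by simp
  then obtain \<delta> where \<delta>: "loc_const \<delta>" "\<forall>x\<in>B - W. \<delta> x \<in> J" "\<forall>j\<in>J. prob ((B - W) \<inter> \<delta> -` {j}) = w j"
    using insert.IH[OF clopen_Diff[OF insert.prems(1) W(1)]] insert.prems(2) by blast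
  define \<delta>' where "\<delta>' x = (if x \<in> W then a else \<delta> x)" for x
  have "loc_const (\<lambda>x. (if x \<in> W then (\<lambda>_. a) else \<delta>) x)"
    using loc_const_glue[OF W(1)[unfolded clopen_iff_loc_const], of "\<lambda>b. if b then (\<lambda>_. a) else \<delta>"]
      \<delta>(1) loc_const_const[of a] by simp
  then have "loc_const \<delta>'"
    by (simp add: \<delta>'_def[abs_def] if_distrib[of "\<lambda>f. f _"])
  moreover have "\<forall>x\<in>B. \<delta>' x \<in> insert a J"
    using \<delta>(2) by (auto simp: \<delta>'_def)
  moreover have "B \<inter> \<delta>' -` {a} = W"
    using \<delta>(2) W(2) insert.hyps(2) by (auto simp: \<delta>'_def split: if_splits)
  moreover have "B \<inter> \<delta>' -` {j} = (B - W) \<inter> \<delta> -` {j}" if "j \<in> J" for j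
    using that insert.hyps(2) by (auto simp: \<delta>'_def split: if_splits)
  ultimately show ?case
    using \<delta>(3) W(3) by (intro exI[of _ \<delta>']) simp
qed

text \<open>One step of back and forth: each cell of \<open>\<psi>\<close> is cut into the masses
  that \<open>\<kappa>\<close> cuts from the cell of \<open>\<phi>\<close> with the same label, and
  the cuts are glued along \<open>\<psi>\<close>.\<close>

lemma label_transfer:
  fixes \<phi> \<psi> :: "cantor \<Rightarrow> 'l" and \<kappa> :: "cantor \<Rightarrow> 'k"
  assumes \<phi>: "loc_const \<phi>" and \<psi>: "loc_const \<psi>" and eq: "\<And>i. prob (\<phi> -` {i}) = prob (\<psi> -` {i})"
    and \<kappa>: "loc_const \<kappa>"
  shows "\<exists>\<delta>. loc_const \<delta> \<and>
    (\<forall>p. prob ((\<lambda>x. (\<phi> x, \<kappa> x)) -` {p}) = prob ((\<lambda>x. (\<psi> x, \<delta> x)) -` {p}))"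
proof -
  have "\<exists>\<delta>. loc_const \<delta> \<and> (\<forall>x\<in>\<psi> -` {i}. \<delta> x \<in> range \<kappa>) \<and>
      (\<forall>j\<in>range \<kappa>. prob (\<psi> -` {i} \<inter> \<delta> -` {j}) = prob (\<phi> -` {i} \<inter> \<kappa> -` {j}))" for i
  proof (rule label_split)
    show "finite (range \<kappa>)"
      using loc_const_finite \<kappa> .
    show "clopen (\<psi> -` {i})"
      using loc_const_clopen \<psi> .
    show "prob (\<phi> -` {i} \<inter> \<kappa> -` {j}) \<in> clopen_values M" for j
      using clopen_Int[OF loc_const_clopen[OF \<phi>] loc_const_clopen[OF \<kappa>]]
      by (auto simp: clopen_values_def)
    have "\<phi> -` {i} = (\<Union>j\<in>range \<kappa>. \<phi> -` {i} \<inter> \<kappa> -` {j})"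
      by auto
    then have "prob (\<phi> -` {i}) = prob (\<Union>j\<in>range \<kappa>. \<phi> -` {i} \<inter> \<kappa> -` {j})"
      by (rule arg_cong)
    also have "\<dots> = (\<Sum>j\<in>range \<kappa>. prob (\<phi> -` {i} \<inter> \<kappa> -` {j}))"
      by (rule finite_measure_finite_Union[OF loc_const_finite[OF \<kappa>]])
        (auto simp: loc_const_measurable \<phi> \<kappa> disjoint_family_on_def)
    finally show "(\<Sum>j\<in>range \<kappa>. prob (\<phi> -` {i} \<inter> \<kappa> -` {j})) = prob (\<psi> -` {i})"
      using eq by simp
  qed
  then have "\<forall>i. \<exists>\<delta>. loc_const \<delta> \<and> (\<forall>x\<in>\<psi> -` {i}. \<delta> x \<in> range \<kappa>) \<and>
      (\<forall>j\<in>range \<kappa>. prob (\<psi> -` {i} \<inter> \<delta> -` {j}) = prob (\<phi> -` {i} \<inter> \<kappa> -` {j}))" ..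
  from choice[OF this] obtain \<delta> where *: "\<forall>i. loc_const (\<delta> i) \<and> (\<forall>x\<in>\<psi> -` {i}. \<delta> i x \<in> range \<kappa>) \<and>
      (\<forall>j\<in>range \<kappa>. prob (\<psi> -` {i} \<inter> \<delta> i -` {j}) = prob (\<phi> -` {i} \<inter> \<kappa> -` {j}))" ..
  have \<delta>: "loc_const (\<delta> i)" "\<psi> x = i \<Longrightarrow> \<delta> i x \<in> range \<kappa>"
    "j \<in> range \<kappa> \<Longrightarrow> prob (\<psi> -` {i} \<inter> \<delta> i -` {j}) = prob (\<phi> -` {i} \<inter> \<kappa> -` {j})" for i j x
    using *[rule_format, of i] by blast+
  have "prob ((\<lambda>x. (\<phi> x, \<kappa> x)) -` {(i, j)}) = prob ((\<lambda>x. (\<psi> x, \<delta> (\<psi> x) x)) -` {(i, j)})" for i j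
  proof (cases "j \<in> range \<kappa>")
    case True
    have "(\<lambda>x. (\<phi> x, \<kappa> x)) -` {(i, j)} = \<phi> -` {i} \<inter> \<kappa> -` {j}"
      "(\<lambda>x. (\<psi> x, \<delta> (\<psi> x) x)) -` {(i, j)} = \<psi> -` {i} \<inter> \<delta> i -` {j}"
      by auto
    then show ?thesis using \<delta>(3)[OF True] by simp
  next
    case False
    then have "(\<lambda>x. (\<phi> x, \<kappa> x)) -` {(i, j)} = {}" "(\<lambda>x. (\<psi> x, \<delta> (\<psi> x) x)) -` {(i, j)} = {}"
      using \<delta>(2) by auto
    then show ?thesis by simp
  qed
  moreover have "loc_const (\<lambda>x. \<delta> (\<psi> x) x)"
    using loc_const_glue[OF \<psi> \<delta>(1)] .
  ultimately show ?thesis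
    by (intro exI[of _ "\<lambda>x. \<delta> (\<psi> x) x"]) auto
qed

text \<open>A clopen set has finite depth, hence is a union of cells of some
  \<open>\<Psi> k\<close>; its preimage is the union of the cells of \<open>\<Phi> k\<close> with
  the same labels.\<close>

lemma limit_carrier:
  fixes \<Phi> \<Psi> :: "nat \<Rightarrow> cantor \<Rightarrow> 'l"
  assumes h: "homeomorphism UNIV UNIV h g" "\<And>k. \<Psi> k \<circ> h = \<Phi> k"
    and sep: "\<And>n. \<exists>k s. cyl n = s \<circ> \<Psi> k"
    and mass: "\<And>k A. prob (\<Phi> k -` A) = prob (\<Psi> k -` A)"
  shows "h \<in> H"
proof (rule carrierI[OF h(1)])
  fix U :: "cantor set" assume "clopen U"
  then obtain n where n: "\<And>x y. cyl n x = cyl n y \<Longrightarrow> x \<in> U \<longleftrightarrow> y \<in> U"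
    unfolding clopen_iff_loc_const using loc_const_factor by blast
  from sep[of n] obtain k s where "cyl n = s \<circ> \<Psi> k"
    by (elim exE)
  then have eq: "cyl n x = cyl n y" if "\<Psi> k x = \<Psi> k y" for x y
    using that by simp
  define B where "B = \<Psi> k ` U"
  have "x \<in> U" if "\<Psi> k x = \<Psi> k y" "y \<in> U" for x y
    using n[OF eq[OF that(1)]] that(2) by simp
  then have U: "U = \<Psi> k -` B"
    unfolding B_def by blast
  have "h -` U = \<Phi> k -` B"
    unfolding h(2)[of k, symmetric] U by auto
  then show "prob (h -` U) = prob U"
    using mass[of k B] U by simp
qed

text \<open>Back and forth with equality of masses as the invariant, refined by
  \<open>label_transfer\<close>. The pairs of labels are recoded by \<open>to_nat\<close> so that
  all stages share one label type.\<close>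

lemma homogeneous_nat:
  fixes \<phi> \<psi> :: "cantor \<Rightarrow> nat"
  assumes "loc_const \<phi>" "loc_const \<psi>" "\<And>i. prob (\<phi> -` {i}) = prob (\<psi> -` {i})"
  shows "\<exists>h\<in>H. \<forall>x. \<psi> (h x) = \<phi> x"
proof -
  define S where "S \<phi> \<psi> \<longleftrightarrow> loc_const \<phi> \<and> loc_const \<psi> \<and> (\<forall>i. prob (\<phi> -` {i}) = prob (\<psi> -` {i}))"
    for \<phi> \<psi> :: "cantor \<Rightarrow> nat"
  have S_sym: "S \<psi> \<phi>" if "S \<phi> \<psi>" for \<phi> \<psi>
    using that by (simp add: S_def)
  have forward: "\<exists>\<phi>' \<psi>' r s. S \<phi>' \<psi>' \<and> \<phi> = r \<circ> \<phi>' \<and> \<psi> = r \<circ> \<psi>' \<and> cyl n = s \<circ> \<phi>'"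
    if S: "S \<phi> \<psi>" for \<phi> \<psi> n
  proof -
    obtain \<delta> :: "cantor \<Rightarrow> bool list" where \<delta>: "loc_const \<delta>"
      "\<And>p. prob ((\<lambda>x. (\<phi> x, cyl n x)) -` {p}) = prob ((\<lambda>x. (\<psi> x, \<delta> x)) -` {p})"
      using label_transfer[of \<phi> \<psi> "cyl n"] S loc_const_cyl unfolding S_def by blast
    have lc: "loc_const (\<lambda>x. (\<phi> x, cyl n x))" "loc_const (\<lambda>x. (\<psi> x, \<delta> x))"
      using S \<delta>(1) loc_const_cyl by (auto simp: S_def intro: loc_const_Pair)
    have "prob ((\<lambda>x. to_nat (\<phi> x, cyl n x)) -` {i}) = prob ((\<lambda>x. to_nat (\<psi> x, \<delta> x)) -` {i})" for i
    proof -
      have "(\<lambda>x. to_nat (\<alpha> x)) -` {i} = \<alpha> -` (to_nat -` {i})" for \<alpha> :: "cantor \<Rightarrow> nat \<times> bool list"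
        by auto
      then show ?thesis
        using same_masses[OF lc \<delta>(2)] by metis
    qed
    then have "S (\<lambda>x. to_nat (\<phi> x, cyl n x)) (\<lambda>x. to_nat (\<psi> x, \<delta> x))"
      unfolding S_def using loc_const_comp[OF lc(1), of to_nat] loc_const_comp[OF lc(2), of to_nat] by simp
    moreover have "\<phi> = (\<lambda>m. fst (from_nat m :: nat \<times> bool list)) \<circ> (\<lambda>x. to_nat (\<phi> x, cyl n x))"
      "\<psi> = (\<lambda>m. fst (from_nat m :: nat \<times> bool list)) \<circ> (\<lambda>x. to_nat (\<psi> x, \<delta> x))"
      "cyl n = (\<lambda>m. snd (from_nat m :: nat \<times> bool list)) \<circ> (\<lambda>x. to_nat (\<phi> x, cyl n x))"
      by (simp_all add: fun_eq_iff)
    ultimately show ?thesis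
      by (intro exI conjI)
  qed
  have "\<exists>h g \<Phi> \<Psi>. homeomorphism UNIV UNIV h g \<and> (\<forall>k::nat. S (\<Phi> k) (\<Psi> k)) \<and> (\<forall>k. \<Psi> k \<circ> h = \<Phi> k) \<and>
    \<Phi> 0 = \<phi> \<and> \<Psi> 0 = \<psi> \<and> (\<forall>n. \<exists>k s. cyl n = s \<circ> \<Psi> k)"
  proof (rule back_and_forth[of S \<phi> \<psi>])
    show "S \<phi> \<psi>"
      using assms by (simp add: S_def)
    show "loc_const \<phi> \<and> loc_const \<psi> \<and> range \<phi> = range \<psi>" if "S \<phi> \<psi>" for \<phi> \<psi>
      using that same_masses_range[of \<phi> \<psi>] by (simp add: S_def)
    show "\<exists>\<phi>' \<psi>' r s. S \<phi>' \<psi>' \<and> \<phi> = r \<circ> \<phi>' \<and> \<psi> = r \<circ> \<psi>' \<and> cyl n = s \<circ> \<psi>'" if "S \<phi> \<psi>" for \<phi> \<psi> n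
    proof -
      from forward[OF S_sym[OF that], of n] obtain \<phi>' \<psi>' r s where
        "S \<phi>' \<psi>'" "\<psi> = r \<circ> \<phi>'" "\<phi> = r \<circ> \<psi>'" "cyl n = s \<circ> \<phi>'"
        by (elim exE conjE)
      then show ?thesis
        by (intro exI conjI) (erule S_sym, assumption+)
    qed
  qed (rule forward)
  then obtain h g \<Phi> \<Psi> where h: "homeomorphism UNIV UNIV h g" "\<forall>k::nat. S (\<Phi> k) (\<Psi> k)" "\<forall>k. \<Psi> k \<circ> h = \<Phi> k"
    "\<Phi> 0 = \<phi>" "\<Psi> 0 = \<psi>" "\<forall>n. \<exists>k s. cyl n = s \<circ> \<Psi> k"
    by (elim exE conjE)
  have "h \<in> H"
  proof (rule limit_carrier[OF h(1)])
    show "\<Psi> k \<circ> h = \<Phi> k" for k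
      using h(3) ..
    show "\<exists>k s. cyl n = s \<circ> \<Psi> k" for n
      using h(6) ..
    show "prob (\<Phi> k -` A) = prob (\<Psi> k -` A)" for k A
      using same_masses[of "\<Phi> k" "\<Psi> k" A] h(2)[rule_format, of k] by (simp add: S_def)
  qed
  moreover have "\<psi> (h x) = \<phi> x" for x
    using h(3)[rule_format, of 0] unfolding h(4,5) by (auto simp: fun_eq_iff)
  ultimately show ?thesis by blast
qed

lemma homogeneous:
  fixes \<phi> \<psi> :: "cantor \<Rightarrow> 'l :: countable"
  assumes "loc_const \<phi>" "loc_const \<psi>" "\<And>i. prob (\<phi> -` {i}) = prob (\<psi> -` {i})"
  shows "\<exists>h\<in>H. \<forall>x. \<psi> (h x) = \<phi> x"
proof -
  have v: "(\<lambda>x. to_nat (\<alpha> x)) -` {i} = \<alpha> -` (to_nat -` {i})" for i and \<alpha> :: "cantor \<Rightarrow> 'l"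
    by auto
  have "\<exists>h\<in>H. \<forall>x. to_nat (\<psi> (h x)) = to_nat (\<phi> x)"
    using homogeneous_nat[OF loc_const_comp[OF assms(1), of to_nat] loc_const_comp[OF assms(2), of to_nat]]
      same_masses[OF assms] by (simp add: v)
  then show ?thesis by simp
qed

lemma permuting_homeo:
  fixes \<rho> :: "cantor \<Rightarrow> 'l :: countable"
  assumes "loc_const \<rho>" "bij p" "\<And>i. prob (\<rho> -` {p i}) = prob (\<rho> -` {i})"
  shows "\<exists>h\<in>H. \<forall>x. \<rho> (h x) = p (\<rho> x)"
proof (rule homogeneous)
  show "loc_const (\<lambda>x. p (\<rho> x))"
    using loc_const_comp[OF assms(1)] .
  fix i
  obtain j where j: "i = p j"
    using assms(2) by (metis bij_pointE)
  have "(\<lambda>x. p (\<rho> x)) -` {i} = \<rho> -` {j}"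
    using assms(2) by (auto simp: j bij_def inj_eq)
  then show "prob ((\<lambda>x. p (\<rho> x)) -` {i}) = prob (\<rho> -` {i})"
    using assms(3)[of j] j by simp
qed (rule assms(1))

end

subsection \<open>The topology of the homeomorphism group\<close>

context good_cantor
begin

abbreviation "T \<equiv> homeo_topology M"
abbreviation "G \<equiv> homeo_group M"
abbreviation "hinv h \<equiv> m_inv (homeo_group M) h"

lemma group_G: "group G"
  using good group_homeo_group by (auto simp: good_measure_def)

lemma hinv_carrier: "h \<in> H \<Longrightarrow> hinv h \<in> H"
  using group.inv_closed[OF group_G] .

lemma hinv_left: "h \<in> H \<Longrightarrow> hinv h (h x) = x"
  using group.l_inv[OF group_G, of h] by (simp add: homeo_group_def fun_eq_iff)

lemma hinv_right: "h \<in> H \<Longrightarrow> h (hinv h x) = x"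
  using group.r_inv[OF group_G, of h] by (simp add: homeo_group_def fun_eq_iff)

lemma comp_carrier: "f \<in> H \<Longrightarrow> h \<in> H \<Longrightarrow> f \<circ> h \<in> H"
  using monoid.m_closed[OF group.is_monoid[OF group_G], of f h] by (simp add: homeo_group_def)

lemma id_carrier: "(\<lambda>x. x) \<in> H"
  using monoid.one_closed[OF group.is_monoid[OF group_G]] by (simp add: homeo_group_def id_def)

lemma conjugacy_class_eq: "conjugacy_class G g = {x \<circ> g \<circ> hinv x | x. x \<in> H}"
  by (simp add: conjugacy_class_def homeo_group_def)

text \<open>Finitely many subbasic conditions suffice, one per label: the compact fibre of
  \<open>\<kappa> \<circ> f\<close> must go into the open fibre of \<open>\<kappa>\<close> over the
  same label.\<close>

lemma open_label_nhd:
  assumes "f \<in> H" and \<kappa>: "loc_const \<kappa>"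
  shows "openin T {f' \<in> H. \<forall>x. \<kappa> (f' x) = \<kappa> (f x)}"
proof -
  have lc: "loc_const (\<lambda>x. \<kappa> (f x))"
    using carrier_loc_const[OF assms] .
  define B where "B l = {f'. continuous_on UNIV f' \<and> f' ` ((\<lambda>x. \<kappa> (f x)) -` {l}) \<subseteq> \<kappa> -` {l}}" for l
  have "openin compact_open_topology (B l)" for l
    unfolding compact_open_topology_def B_def
  proof (rule topology_generated_by_Basis)
    have "compact ((\<lambda>x. \<kappa> (f x)) -` {l})"
      using loc_const_clopen[OF lc] by (simp add: closed_compact_cantor clopen_def)
    moreover have "open (\<kappa> -` {l})"
      using \<kappa> by (simp add: loc_const_def)
    ultimately show "{f'. continuous_on UNIV f' \<and> f' ` ((\<lambda>x. \<kappa> (f x)) -` {l}) \<subseteq> \<kappa> -` {l}}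
      \<in> {{f. continuous_on UNIV f \<and> f ` K \<subseteq> U} |K U. compact K \<and> open U}"
      by blast
  qed
  then have "openin compact_open_topology (\<Inter>l\<in>range \<kappa>. B l)"
    using loc_const_finite[OF \<kappa>] by (intro openin_Inter) auto
  then have "openin T ((\<Inter>l\<in>range \<kappa>. B l) \<inter> H)"
    unfolding homeo_topology_def by (rule openin_subtopology_Int)
  also have "(\<Inter>l\<in>range \<kappa>. B l) \<inter> H = {f' \<in> H. \<forall>x. \<kappa> (f' x) = \<kappa> (f x)}"
  proof (intro Set.set_eqI iffI)
    fix f' assume "f' \<in> (\<Inter>l\<in>range \<kappa>. B l) \<inter> H"
    then have "f' \<in> H" "\<And>x. f' \<in> B (\<kappa> (f x))"
      by auto
    then show "f' \<in> {f' \<in> H. \<forall>x. \<kappa> (f' x) = \<kappa> (f x)}"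
      unfolding B_def by blast
  next
    fix f' assume "f' \<in> {f' \<in> H. \<forall>x. \<kappa> (f' x) = \<kappa> (f x)}"
    then show "f' \<in> (\<Inter>l\<in>range \<kappa>. B l) \<inter> H"
      using carrier_cont[of f'] by (auto simp: B_def)
  qed
  finally show ?thesis .
qed

text \<open>On a compact domain the compact-open topology is that of uniform convergence, here
  measured by cylinders. For a subbasic set the uniform depth comes from
  \<open>compact_cyl_nhd\<close>, applied to the image of the compact set.\<close>

lemma openin_homeo_iff:
  "openin T S \<longleftrightarrow> S \<subseteq> H \<and> (\<forall>f\<in>S. \<exists>n. \<forall>f'\<in>H. (\<forall>x. cyl n (f' x) = cyl n (f x)) \<longrightarrow> f' \<in> S)"
proof
  assume "openin T S"
  then obtain R where R: "openin compact_open_topology R" "S = R \<inter> H"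
    unfolding homeo_topology_def openin_subtopology by blast
  have "generate_topology_on {{f. continuous_on UNIV f \<and> f ` K \<subseteq> U} | K U. compact K \<and> open U} R"
    using R(1) unfolding compact_open_topology_def by (rule openin_topology_generated_by)
  then have "\<forall>f\<in>R. \<exists>n. \<forall>f'\<in>H. (\<forall>x. cyl n (f' x) = cyl n (f x)) \<longrightarrow> f' \<in> R"
  proof induction
    case (Int a b)
    show ?case
    proof
      fix f assume f: "f \<in> a \<inter> b"
      obtain n where n: "\<And>f'. f' \<in> H \<Longrightarrow> (\<forall>x. cyl n (f' x) = cyl n (f x)) \<Longrightarrow> f' \<in> a"
        using Int f by blast
      obtain m where m: "\<And>f'. f' \<in> H \<Longrightarrow> (\<forall>x. cyl m (f' x) = cyl m (f x)) \<Longrightarrow> f' \<in> b"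
        using Int f by blast
      have "f' \<in> a \<inter> b" if "f' \<in> H" "\<forall>x. cyl (max n m) (f' x) = cyl (max n m) (f x)" for f'
      proof
        have "cyl n (f' x) = cyl n (f x)" "cyl m (f' x) = cyl m (f x)" for x
          by (rule cyl_mono[OF that(2)[rule_format]], simp)+
        then show "f' \<in> a" "f' \<in> b"
          using n[OF that(1)] m[OF that(1)] by blast+
      qed
      then show "\<exists>n. \<forall>f'\<in>H. (\<forall>x. cyl n (f' x) = cyl n (f x)) \<longrightarrow> f' \<in> a \<inter> b"
        by blast
    qed
  next
    case (UN K)
    show ?case
    proof
      fix f assume "f \<in> \<Union>K"
      then obtain k where "k \<in> K" "f \<in> k" by blast
      then show "\<exists>n. \<forall>f'\<in>H. (\<forall>x. cyl n (f' x) = cyl n (f x)) \<longrightarrow> f' \<in> \<Union>K"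
        using UN by (meson UnionI)
    qed
  next
    case (Basis s)
    then obtain K U where s: "s = {f. continuous_on UNIV f \<and> f ` K \<subseteq> U}" "compact K" "open U"
      by blast
    show ?case
    proof
      fix f assume "f \<in> s"
      then have f: "continuous_on UNIV f" "f ` K \<subseteq> U"
        by (simp_all add: s(1))
      have "compact (f ` K)"
        by (rule compact_continuous_image[OF continuous_on_subset[OF f(1)] s(2)]) simp
      then obtain n where n: "\<And>x y. x \<in> f ` K \<Longrightarrow> cyl n y = cyl n x \<Longrightarrow> y \<in> U"
        using compact_cyl_nhd[OF _ s(3) f(2)] by blast
      have "f' \<in> s" if f': "f' \<in> H" "\<forall>x. cyl n (f' x) = cyl n (f x)" for f'
      proof -
        have "f' x \<in> U" if "x \<in> K" for x
          using n[of "f x" "f' x"] f'(2) that by simp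
        then show ?thesis
          using carrier_cont[OF f'(1)] by (auto simp: s(1))
      qed
      then show "\<exists>n. \<forall>f'\<in>H. (\<forall>x. cyl n (f' x) = cyl n (f x)) \<longrightarrow> f' \<in> s"
        by blast
    qed
  qed simp
  then show "S \<subseteq> H \<and> (\<forall>f\<in>S. \<exists>n. \<forall>f'\<in>H. (\<forall>x. cyl n (f' x) = cyl n (f x)) \<longrightarrow> f' \<in> S)"
    unfolding R(2) by blast
next
  assume S: "S \<subseteq> H \<and> (\<forall>f\<in>S. \<exists>n. \<forall>f'\<in>H. (\<forall>x. cyl n (f' x) = cyl n (f x)) \<longrightarrow> f' \<in> S)"
  show "openin T S"
  proof (subst openin_subopen, rule ballI)
    fix f assume f: "f \<in> S"
    then obtain n where "\<forall>f'\<in>H. (\<forall>x. cyl n (f' x) = cyl n (f x)) \<longrightarrow> f' \<in> S"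
      using S by blast
    then have "{f' \<in> H. \<forall>x. cyl n (f' x) = cyl n (f x)} \<subseteq> S"
      by blast
    moreover have "openin T {f' \<in> H. \<forall>x. cyl n (f' x) = cyl n (f x)}"
      using open_label_nhd[OF _ loc_const_cyl] f S by blast
    ultimately show "\<exists>R. openin T R \<and> f \<in> R \<and> R \<subseteq> S"
      using f S by blast
  qed
qed

lemma openin_homeoI:
  assumes "S \<subseteq> H"
    and "\<And>f. f \<in> S \<Longrightarrow> \<exists>\<kappa> :: cantor \<Rightarrow> nat. loc_const \<kappa> \<and> (\<forall>f'\<in>H. (\<forall>x. \<kappa> (f' x) = \<kappa> (f x)) \<longrightarrow> f' \<in> S)"
  shows "openin T S"
proof (subst openin_subopen, rule ballI)
  fix f assume f: "f \<in> S"
  then obtain \<kappa> :: "cantor \<Rightarrow> nat" where \<kappa>: "loc_const \<kappa>" "\<forall>f'\<in>H. (\<forall>x. \<kappa> (f' x) = \<kappa> (f x)) \<longrightarrow> f' \<in> S"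
    using assms(2) by blast
  show "\<exists>R. openin T R \<and> f \<in> R \<and> R \<subseteq> S"
    using open_label_nhd[OF _ \<kappa>(1), of f] \<kappa>(2) f assms(1)
    by (intro exI[of _ "{f' \<in> H. \<forall>x. \<kappa> (f' x) = \<kappa> (f x)}"]) blast
qed

section \<open>Baire category in the homeomorphism group\<close>

lemma nowhere_dense_avoid:
  assumes "nowhere_dense_in T N" "openin T W" "W \<noteq> {}"
  shows "\<exists>f\<in>W. \<exists>n. \<forall>f'\<in>H. (\<forall>x. cyl n (f' x) = cyl n (f x)) \<longrightarrow> f' \<in> W - N"
proof -
  define C where "C = Abstract_Topology.closure_of T N"
  have C: "closedin T C" "N \<subseteq> C" "T interior_of C = {}"
    using assms(1) closure_of_subset[of N T] by (auto simp: C_def nowhere_dense_in_def)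
  have "W - C \<noteq> {}"
    using interior_of_maximal[of W C T] assms(2,3) C(3) by blast
  then obtain f where f: "f \<in> W - C"
    by blast
  have "openin T (W - C)"
    using assms(2) C(1) by (rule openin_diff)
  then obtain n where "\<forall>f'\<in>H. (\<forall>x. cyl n (f' x) = cyl n (f x)) \<longrightarrow> f' \<in> W - C"
    using f unfolding openin_homeo_iff by blast
  then show ?thesis
    using f C(2) by blast
qed

text \<open>The approximants and their inverses are both stabilised on ever finer cylinders, so that the
  limit is again a homeomorphism.\<close>

lemma baire:
  assumes cF: "countable F" and nd: "\<And>N. N \<in> F \<Longrightarrow> nowhere_dense_in T N"
    and W: "openin T W" "W \<noteq> {}"
  shows "\<exists>f\<in>W. f \<notin> \<Union>F"
proof -
  \<comment> \<open>Adding the empty set makes the family nonempty, as an enumeration by the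
    naturals requires.\<close>
  define ND where "ND = from_nat_into (insert {} F)"
  have rND: "range ND = insert {} F"
    unfolding ND_def using cF by (intro range_from_nat_into) auto
  have nd': "nowhere_dense_in T (ND k)" for k
  proof -
    have "nowhere_dense_in T {}"
      by (simp add: nowhere_dense_in_def)
    then show ?thesis
      using rND nd by (metis insertE rangeI)
  qed
  define B where "B p = {f' \<in> H. (\<forall>x. cyl (snd p) (f' x) = cyl (snd p) (fst p x)) \<and>
      (\<forall>x. cyl (snd p) (hinv f' x) = cyl (snd p) (hinv (fst p) x))}"
    for p :: "(cantor \<Rightarrow> cantor) \<times> nat"
  have open_B: "openin T (B p)" if "fst p \<in> H" for p
  proof -
    define \<kappa> where "\<kappa> x = cyl (snd p) (hinv (fst p) x)" for x
    have "loc_const \<kappa>"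
      unfolding \<kappa>_def using carrier_loc_const[OF hinv_carrier[OF that] loc_const_cyl] .
    then have "openin T ({f' \<in> H. \<forall>x. cyl (snd p) (f' x) = cyl (snd p) (fst p x)} \<inter>
        {f' \<in> H. \<forall>x. \<kappa> (f' x) = \<kappa> (fst p x)})"
      using that by (intro openin_Int open_label_nhd loc_const_cyl) auto
    also have "\<dots> = B p"
    proof -
      \<comment> \<open>At \<open>fst p x\<close> the label \<open>\<kappa>\<close> reads off the
        cylinder of \<open>x\<close>. So agreement means
        \<open>\<kappa> (f' x) = cyl (snd p) x\<close>, and the substitution \<open>y = f' x\<close>
        turns this into a condition on the inverse of \<open>f'\<close>.\<close>
      have "(\<forall>x. \<kappa> (f' x) = \<kappa> (fst p x)) \<longleftrightarrow> (\<forall>x. cyl (snd p) (hinv f' x) = cyl (snd p) (hinv (fst p) x))"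
        if f': "f' \<in> H" for f'
      proof -
        have "(\<forall>x. \<kappa> (f' x) = \<kappa> (fst p x)) \<longleftrightarrow> (\<forall>x. \<kappa> (f' x) = cyl (snd p) x)"
          using \<open>fst p \<in> H\<close> by (simp add: \<kappa>_def hinv_left)
        also have "\<dots> \<longleftrightarrow> (\<forall>y. \<kappa> y = cyl (snd p) (hinv f' y))"
          using f' by (metis hinv_left hinv_right)
        finally show ?thesis
          by (auto simp: \<kappa>_def)
      qed
      then show ?thesis
        by (auto simp: B_def)
    qed
    finally show ?thesis .
  qed
  obtain f0 n0 where f0: "f0 \<in> W" "f0 \<in> H" "\<And>f'. f' \<in> H \<Longrightarrow> (\<forall>x. cyl n0 (f' x) = cyl n0 (f0 x)) \<Longrightarrow> f' \<in> W"
    using W unfolding openin_homeo_iff by blast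
  have "\<exists>p. \<forall>k. (fst (p k) \<in> H \<and> (k = 0 \<longrightarrow> p k = (f0, n0))) \<and>
      (snd (p k) < snd (p (Suc k)) \<and> fst (p (Suc k)) \<in> B (p k) \<and>
       (\<forall>f'\<in>H. (\<forall>x. cyl (snd (p (Suc k))) (f' x) = cyl (snd (p (Suc k))) (fst (p (Suc k)) x)) \<longrightarrow> f' \<notin> ND k))"
  proof (rule dependent_nat_choice)
    show "\<exists>p. fst p \<in> H \<and> (0 = 0 \<longrightarrow> p = (f0, n0))"
      using f0(2) by auto
    fix p :: "(cantor \<Rightarrow> cantor) \<times> nat" and k :: nat
    assume "fst p \<in> H \<and> (k = 0 \<longrightarrow> p = (f0, n0))"
    then have p: "fst p \<in> H" by blast
    then have "fst p \<in> B p"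
      by (simp add: B_def)
    then obtain f n where f: "f \<in> B p"
      "\<forall>f'\<in>H. (\<forall>x. cyl n (f' x) = cyl n (f x)) \<longrightarrow> f' \<in> B p - ND k"
      using nowhere_dense_avoid[OF nd' open_B[OF p], of k] by blast
    \<comment> \<open>Strict growth of the depth gives \<open>k \<le> n k\<close> later, so every
      coordinate is settled in the limit.\<close>
    define m where "m = max n (Suc (snd p))"
    have "f' \<notin> ND k" if "f' \<in> H" "\<forall>x. cyl m (f' x) = cyl m (f x)" for f'
    proof -
      have "cyl n (f' x) = cyl n (f x)" for x
        by (rule cyl_mono[OF that(2)[rule_format]]) (simp add: m_def)
      then show ?thesis
        using f(2) that(1) by blast
    qed
    moreover have "snd p < m" "f \<in> H"
      using f(1) by (auto simp: m_def B_def)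
    ultimately show "\<exists>q. (fst q \<in> H \<and> (Suc k = 0 \<longrightarrow> q = (f0, n0))) \<and>
       (snd p < snd q \<and> fst q \<in> B p \<and>
       (\<forall>f'\<in>H. (\<forall>x. cyl (snd q) (f' x) = cyl (snd q) (fst q x)) \<longrightarrow> f' \<notin> ND k))"
      using f(1) by (intro exI[of _ "(f, m)"]) simp
  qed
  then obtain p where p: "\<forall>k. (fst (p k) \<in> H \<and> (k = 0 \<longrightarrow> p k = (f0, n0))) \<and>
      (snd (p k) < snd (p (Suc k)) \<and> fst (p (Suc k)) \<in> B (p k) \<and>
       (\<forall>f'\<in>H. (\<forall>x. cyl (snd (p (Suc k))) (f' x) = cyl (snd (p (Suc k))) (fst (p (Suc k)) x)) \<longrightarrow> f' \<notin> ND k))"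
    by blast
  define f where "f k = fst (p k)" for k
  define n where "n k = snd (p k)" for k
  have fH: "f k \<in> H" for k
    using p by (simp add: f_def)
  have f_0: "f 0 = f0" "n 0 = n0"
    using p[rule_format, of 0] by (simp_all add: f_def n_def)
  have n_Suc: "n k < n (Suc k)" for k
    using p by (simp add: n_def)
  have f_Suc: "cyl (n k) (f (Suc k) x) = cyl (n k) (f k x)"
    "cyl (n k) (hinv (f (Suc k)) x) = cyl (n k) (hinv (f k) x)" for k x
    using p[rule_format, of k] by (simp_all add: B_def f_def n_def)
  have avoid: "f' \<notin> ND k" if "f' \<in> H" "\<forall>x. cyl (n (Suc k)) (f' x) = cyl (n (Suc k)) (f (Suc k) x)" for f' k
    using p[rule_format, of k] that unfolding f_def n_def by blast
  have n_ge: "k \<le> n k" for k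
  proof (induction k)
    case (Suc k)
    then show ?case using n_Suc[of k] by linarith
  qed simp
  \<comment> \<open>The labels satisfy \<open>\<psi> k \<circ> f k = \<phi> k\<close>. One component
    of each records the point itself, which gives separation; the other follows \<open>f k\<close>
    or its inverse.\<close>
  define \<phi> where "\<phi> k x = (cyl (n k) (f k x), cyl (n k) x)" for k x
  define \<psi> where "\<psi> k x = (cyl (n k) x, cyl (n k) (hinv (f k) x))" for k x
  have "\<exists>h g. homeomorphism UNIV UNIV h g \<and> (\<forall>k. \<psi> k \<circ> h = \<phi> k)"
  proof (rule limit_homeomorphism)
    fix k
    show "loc_const (\<phi> k)" "loc_const (\<psi> k)"
      using loc_const_Pair[OF carrier_loc_const[OF fH loc_const_cyl[of "n k"], of k] loc_const_cyl[of "n k"]]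
        loc_const_Pair[OF loc_const_cyl[of "n k"] carrier_loc_const[OF hinv_carrier[OF fH] loc_const_cyl[of "n k"], of k]]
      by (simp_all only: \<phi>_def[abs_def] \<psi>_def[abs_def])
    have eqs: "\<phi> k x = \<psi> k (f k x)" "\<psi> k x = \<phi> k (hinv (f k) x)" for x
      by (simp_all add: \<phi>_def \<psi>_def fH hinv_left hinv_right)
    have "\<phi> k x \<in> range (\<psi> k)" "\<psi> k x \<in> range (\<phi> k)" for x
      by (subst eqs(1), rule rangeI) (subst eqs(2), rule rangeI)
    then show "range (\<phi> k) = range (\<psi> k)"
      by (intro equalityI image_subsetI)
    have le: "n k \<le> n (Suc k)"
      using n_Suc[of k] by simp
    show "\<exists>r. \<phi> k = r \<circ> \<phi> (Suc k) \<and> \<psi> k = r \<circ> \<psi> (Suc k)"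
      by (rule exI[of _ "map_prod (take (n k)) (take (n k))"])
        (simp add: fun_eq_iff \<phi>_def \<psi>_def cyl_take[OF le, symmetric] f_Suc)
  next
    fix k
    show "\<exists>m s. cyl k = s \<circ> \<phi> m"
      by (rule exI[of _ k], rule exI[of _ "\<lambda>z. take k (snd z)"])
        (simp add: fun_eq_iff \<phi>_def cyl_take[OF n_ge, symmetric])
    show "\<exists>m s. cyl k = s \<circ> \<psi> m"
      by (rule exI[of _ k], rule exI[of _ "\<lambda>z. take k (fst z)"])
        (simp add: fun_eq_iff \<psi>_def cyl_take[OF n_ge, symmetric])
  qed
  then obtain h g where h: "homeomorphism UNIV UNIV h g" "\<forall>k. \<psi> k \<circ> h = \<phi> k"
    by blast
  have hf: "cyl (n k) (h x) = cyl (n k) (f k x)" for k x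
    using fun_cong[OF h(2)[rule_format, of k], of x] by (simp add: \<phi>_def \<psi>_def)
  have "h \<in> H"
  proof (rule carrierI[OF h(1)])
    fix U :: "cantor set" assume U: "clopen U"
    then obtain k where k: "\<And>x y. cyl k x = cyl k y \<Longrightarrow> x \<in> U \<longleftrightarrow> y \<in> U"
      unfolding clopen_iff_loc_const using loc_const_factor by blast
    have "h x \<in> U \<longleftrightarrow> f k x \<in> U" for x
      by (rule k) (rule cyl_mono[OF hf n_ge])
    then have "h -` U = f k -` U"
      by auto
    then show "prob (h -` U) = prob U"
      using carrier_prob[OF fH U] by simp
  qed
  moreover have "h \<in> W"
    using f0(3)[OF \<open>h \<in> H\<close>] hf[of 0] f_0 by simp
  moreover have "h \<notin> ND k" for k
    using avoid[OF \<open>h \<in> H\<close>] hf by blast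
  then have "h \<notin> \<Union>F"
    using rND by blast
  ultimately show ?thesis by blast
qed

lemma comeager_imp_dense:
  assumes "comeager_in T C"
  shows "dense_in T C"
proof -
  from assms obtain F where F: "C \<subseteq> topspace T" "countable F" "\<forall>N\<in>F. nowhere_dense_in T N" "topspace T - C = \<Union>F"
    unfolding comeager_in_def meager_in_def by (elim conjE exE)
  have "C \<inter> W \<noteq> {}" if W: "openin T W" "W \<noteq> {}" for W
  proof -
    obtain f where "f \<in> W" "f \<notin> \<Union>F"
      using baire[OF F(2) F(3)[rule_format] W] by blast
    then show ?thesis
      using F(4) openin_subset[OF W(1)] by blast
  qed
  then show ?thesis
    using F(1) by (simp add: dense_in_def dense_intersects_open)
qed

subsection \<open>The group generated by the clopen values\<close>

lemma V_0: "0 \<in> clopen_values M" and V_1: "1 \<in> clopen_values M"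
proof -
  have "0 = prob {}" "1 = prob UNIV"
    by (simp_all add: prob_UNIV)
  then show "0 \<in> clopen_values M" "1 \<in> clopen_values M"
    unfolding clopen_values_def using clopen_empty clopen_UNIV by blast+
qed

lemma V_bounds: "v \<in> clopen_values M \<Longrightarrow> 0 \<le> v \<and> v \<le> 1"
  by (auto simp: clopen_values_def)

lemma V_compl: "v \<in> clopen_values M \<Longrightarrow> 1 - v \<in> clopen_values M"
proof -
  assume "v \<in> clopen_values M"
  then obtain U where U: "clopen U" "v = prob U"
    by (auto simp: clopen_values_def)
  have "1 - v = prob (UNIV - U)"
    using prob_compl[OF clopen_measurable[OF U(1)]] U(2) by (simp add: space_M)
  then show ?thesis
    using clopen_Diff[OF clopen_UNIV U(1)] by (auto simp: clopen_values_def)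
qed

lemma V_add:
  assumes "u \<in> clopen_values M" "v \<in> clopen_values M" "u + v \<le> 1"
  shows "u + v \<in> clopen_values M"
proof -
  obtain A B where AB: "clopen A" "u = prob A" "clopen B" "v = prob B"
    using assms by (auto simp: clopen_values_def)
  have "prob (UNIV - B) = 1 - prob B"
    using prob_compl[OF clopen_measurable[OF AB(3)]] by (simp add: space_M)
  then obtain W where W: "clopen W" "W \<subseteq> UNIV - B" "prob W = u"
    using clopen_subset[OF AB(1) clopen_Diff[OF clopen_UNIV AB(3)]] AB assms(3) by auto
  have "prob (W \<union> B) = prob W + prob B"
    using W AB by (intro finite_measure_Union clopen_measurable) auto
  then have "u + v = prob (W \<union> B)"
    using W AB by simp
  moreover have "clopen (W \<union> B)"
    using W AB by (auto simp: clopen_def)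
  ultimately show ?thesis
    unfolding clopen_values_def by blast
qed

abbreviation "GV \<equiv> plus_ints (clopen_values M)"

lemma GV_I: "v \<in> clopen_values M \<Longrightarrow> v + real_of_int k \<in> GV"
  by (auto simp: plus_ints_def)

lemma GV_V: "v \<in> clopen_values M \<Longrightarrow> v \<in> GV"
  using GV_I[of v 0] by simp

text \<open>The way back from the group to the values: an element of the unit interval differs from
  a value by -1, 0 or 1, and a nonzero difference forces it to be 0 or 1.\<close>

lemma GV_unit:
  assumes "a \<in> GV" "0 \<le> a" "a \<le> 1"
  shows "a \<in> clopen_values M"
proof -
  obtain v k where v: "a = v + real_of_int k" "v \<in> clopen_values M"
    using assms(1) by (auto simp: plus_ints_def)
  have "-1 \<le> real_of_int k" "real_of_int k \<le> 1"
    using V_bounds[OF v(2)] assms v(1) by linarith+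
  then have "-1 \<le> k" "k \<le> 1"
    by linarith+
  then have "k = -1 \<or> k = 0 \<or> k = 1"
    by linarith
  then show ?thesis
  proof (elim disjE)
    assume "k = -1"
    then have "a = 0" using V_bounds[OF v(2)] v(1) assms by simp
    then show ?thesis using V_0 by simp
  next
    assume "k = 0"
    then show ?thesis using v by simp
  next
    assume "k = 1"
    then have "a = 1" using V_bounds[OF v(2)] v(1) assms by simp
    then show ?thesis using V_1 by simp
  qed
qed

lemma GV_add:
  assumes "a \<in> GV" "b \<in> GV"
  shows "a + b \<in> GV"
proof -
  obtain u k v l where uv: "a = u + real_of_int k" "u \<in> clopen_values M" "b = v + real_of_int l" "v \<in> clopen_values M"
    using assms by (auto simp: plus_ints_def)
  show ?thesis
  proof (cases "u + v \<le> 1")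
    case True
    have "a + b = (u + v) + real_of_int (k + l)"
      using uv by simp
    then show ?thesis
      using GV_I[OF V_add[OF uv(2,4) True]] by metis
  next
    case False
    \<comment> \<open>Beyond 1 the sum wraps around: the complements have sum below 1, and the
      complement of that sum is \<open>u + v - 1\<close>.\<close>
    have "(1 - u) + (1 - v) \<in> clopen_values M"
      using V_add[OF V_compl[OF uv(2)] V_compl[OF uv(4)]] False by simp
    from V_compl[OF this] have "u + v - 1 \<in> clopen_values M"
      by (simp add: algebra_simps)
    moreover have "a + b = (u + v - 1) + real_of_int (k + l + 1)"
      using uv by simp
    ultimately show ?thesis
      using GV_I by metis
  qed
qed

lemma GV_uminus:
  assumes "a \<in> GV"
  shows "- a \<in> GV"
proof -
  obtain u k where u: "a = u + real_of_int k" "u \<in> clopen_values M"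
    using assms by (auto simp: plus_ints_def)
  have "- a = (1 - u) + real_of_int (- k - 1)"
    using u by simp
  then show ?thesis
    using GV_I[OF V_compl[OF u(2)]] by metis
qed

lemma GV_int_mult:
  assumes "a \<in> GV"
  shows "real_of_int k * a \<in> GV"
proof -
  have nat: "real n * a \<in> GV" for n
  proof (induction n)
    case 0
    then show ?case using GV_V[OF V_0] by simp
  next
    case (Suc n)
    then show ?case using GV_add[OF assms Suc] by (simp add: algebra_simps)
  qed
  show ?thesis
  proof (cases "0 \<le> k")
    case True
    then show ?thesis using nat[of "nat k"] by simp
  next
    case False
    then show ?thesis using GV_uminus[OF nat[of "nat (- k)"]] by simp
  qed
qed

lemma GV_int: "real_of_int k \<in> GV"
  using GV_int_mult[OF GV_V[OF V_1], of k] by simp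

text \<open>Bezout coefficients with x m + y n = 1 give 1/n = x v + y, an element of the group that
  lies in the unit interval.\<close>

lemma V_fraction:
  assumes "v \<in> clopen_values M" "v \<in> \<rat>"
  obtains m n :: nat where "n \<noteq> 0" "v = real m / real n" "1 / real n \<in> clopen_values M"
proof -
  obtain m n :: nat where mn: "n \<noteq> 0" "\<bar>v\<bar> = real m / real n" "coprime m n"
    using Rats_abs_nat_div_natE[OF assms(2)] .
  have v: "v = real m / real n"
    using mn(2) V_bounds[OF assms(1)] by simp
  obtain x y where "x * int m + y * int n = 1"
    using bezout_int[of "int m" "int n"] mn(3) by (auto simp: gcd_int_int_eq)
  then have "real_of_int (x * int m + y * int n) = 1"
    by (simp only: of_int_1)
  then have "1 / real n = real_of_int x * v + real_of_int y"
    using mn(1) by (simp add: v field_simps)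
  then have "1 / real n \<in> GV"
    using GV_add[OF GV_int_mult[OF GV_V[OF assms(1)]] GV_int] by simp
  then have "1 / real n \<in> clopen_values M"
    using mn(1) by (intro GV_unit) auto
  then show thesis
    using that mn(1) v by blast
qed

text \<open>\<open>GV\<close> is already a group containing the integers. In the product of
  \<open>u + k\<close> and \<open>v + l\<close>, every term except \<open>u * v\<close> is an
  integer or an integer multiple of a value.\<close>

lemma subring_iff:
  "subring GV (ring_of_type_algebra :: real ring) \<longleftrightarrow>
    (\<forall>u\<in>clopen_values M. \<forall>v\<in>clopen_values M. u * v \<in> GV)"
proof
  assume "subring GV (ring_of_type_algebra :: real ring)"
  from subringE(6)[OF this] show "\<forall>u\<in>clopen_values M. \<forall>v\<in>clopen_values M. u * v \<in> GV"
    using GV_V by (simp add: ring_of_type_algebra_def)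
next
  assume *: "\<forall>u\<in>clopen_values M. \<forall>v\<in>clopen_values M. u * v \<in> GV"
  interpret R: ring "ring_of_type_algebra :: real ring"
    by (rule ring_from_type_algebra)
  have neg: "\<ominus>\<^bsub>ring_of_type_algebra\<^esub> a = - a" for a :: real
    by (rule R.minus_equality) (simp_all add: ring_of_type_algebra_def)
  show "subring GV (ring_of_type_algebra :: real ring)"
  proof (rule R.subringI)
    fix a b assume "a \<in> GV" "b \<in> GV"
    then obtain u k v l where uv: "a = u + real_of_int k" "u \<in> clopen_values M"
      "b = v + real_of_int l" "v \<in> clopen_values M"
      by (auto simp: plus_ints_def)
    have "a * b = u * v + (real_of_int l * u + (real_of_int k * v + real_of_int (k * l)))"
      by (simp add: uv algebra_simps)
    moreover have "u * v \<in> GV"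
      using * uv by blast
    ultimately have "a * b \<in> GV"
      using GV_add GV_int_mult[OF GV_V[OF uv(2)]] GV_int_mult[OF GV_V[OF uv(4)]] GV_int by metis
    then show "a \<otimes>\<^bsub>ring_of_type_algebra\<^esub> b \<in> GV"
      by (simp add: ring_of_type_algebra_def)
    assume "a \<in> GV" "b \<in> GV"
    then show "a \<oplus>\<^bsub>ring_of_type_algebra\<^esub> b \<in> GV"
      by (simp add: ring_of_type_algebra_def GV_add)
  next
    fix a assume "a \<in> GV"
    then show "\<ominus>\<^bsub>ring_of_type_algebra\<^esub> a \<in> GV"
      by (simp add: neg GV_uminus)
  qed (simp_all add: ring_of_type_algebra_def GV_V[OF V_1])
qed

section \<open>Divisibility forced by a dense conjugacy class\<close>

lemma equal_partition:
  assumes "1 / real n \<in> clopen_values M" "n \<noteq> 0"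
  shows "\<exists>\<phi> :: cantor \<Rightarrow> nat. loc_const \<phi> \<and> (\<forall>x. \<phi> x < n) \<and> (\<forall>i<n. prob (\<phi> -` {i}) = 1 / real n)"
proof -
  have "\<exists>\<delta>. loc_const \<delta> \<and> (\<forall>x\<in>UNIV. \<delta> x \<in> {..<n}) \<and> (\<forall>j\<in>{..<n}. prob (UNIV \<inter> \<delta> -` {j}) = 1 / real n)"
    by (rule label_split) (use assms clopen_UNIV prob_UNIV in auto)
  then show ?thesis
    by (simp only: lessThan_iff UNIV_I Int_UNIV_left ball_UNIV Ball_def simp_thms)
qed

lemma dense_class_imp_divisible:
  assumes g: "g \<in> H" "dense_in T (conjugacy_class G g)"
    and n: "1 / real n \<in> clopen_values M" "n \<noteq> 0" and w: "w \<in> clopen_values M"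
  shows "w / real n \<in> clopen_values M"
proof -
  define W1 where "W1 = {f \<in> H. \<exists>\<phi> :: cantor \<Rightarrow> nat. loc_const \<phi> \<and> (\<forall>x. \<phi> x < n) \<and> (\<forall>x. \<phi> (f x) = Suc (\<phi> x) mod n)}"
  define W2 where "W2 = {f \<in> H. \<exists>B. clopen B \<and> prob B = w \<and> (\<forall>x. f x \<in> B \<longleftrightarrow> x \<in> B)}"
  have meets: "\<exists>x\<in>H. x \<circ> g \<circ> hinv x \<in> W" if "openin T W" "W \<noteq> {}" for W
    using g(2) that unfolding dense_in_def dense_intersects_open conjugacy_class_eq by blast
  have "openin T W1"
  proof (rule openin_homeoI)
    fix f assume "f \<in> W1"
    then obtain \<phi> :: "cantor \<Rightarrow> nat" where \<phi>: "loc_const \<phi>" "\<forall>x. \<phi> x < n" "\<forall>x. \<phi> (f x) = Suc (\<phi> x) mod n"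
      unfolding W1_def by blast
    have "f' \<in> W1" if "f' \<in> H" "\<forall>x. \<phi> (f' x) = \<phi> (f x)" for f'
      unfolding W1_def using \<phi> that by auto
    then show "\<exists>\<kappa> :: cantor \<Rightarrow> nat. loc_const \<kappa> \<and> (\<forall>f'\<in>H. (\<forall>x. \<kappa> (f' x) = \<kappa> (f x)) \<longrightarrow> f' \<in> W1)"
      using \<phi>(1) by blast
  qed (auto simp: W1_def)
  moreover have "W1 \<noteq> {}"
  proof -
    obtain \<phi> :: "cantor \<Rightarrow> nat" where \<phi>: "loc_const \<phi>" "\<And>x. \<phi> x < n" "\<And>i. i < n \<Longrightarrow> prob (\<phi> -` {i}) = 1 / real n"
      using equal_partition[OF n] by blast
    have "prob ((\<lambda>x. Suc (\<phi> x) mod n) -` {i}) = prob (\<phi> -` {i})" for i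
    proof (cases "i < n")
      case True
      \<comment> \<open>The cyclic predecessor of \<open>i\<close> modulo \<open>n\<close>.\<close>
      define j where "j = (if i = 0 then n - 1 else i - 1)"
      have "Suc (\<phi> x) mod n = i \<longleftrightarrow> \<phi> x = j" for x
      proof (cases "Suc (\<phi> x) = n")
        case True
        then show ?thesis using \<phi>(2)[of x] \<open>i < n\<close> by (auto simp: j_def)
      next
        case False
        then have "Suc (\<phi> x) < n"
          using \<phi>(2)[of x] by simp
        then show ?thesis using \<open>i < n\<close> by (auto simp: j_def)
      qed
      then have "(\<lambda>x. Suc (\<phi> x) mod n) -` {i} = \<phi> -` {j}"
        by auto
      moreover have "j < n"
        using True by (auto simp: j_def)
      ultimately show ?thesis
        using \<phi>(3) True by simp
    next
      case False
      then have "Suc (\<phi> x) mod n \<noteq> i" "\<phi> x \<noteq> i" for x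
        using \<phi>(2)[of x] n(2) by (metis mod_less_divisor neq0_conv, metis)
      then have "(\<lambda>x. Suc (\<phi> x) mod n) -` {i} = {}" "\<phi> -` {i} = {}"
        by auto
      then show ?thesis by simp
    qed
    then obtain h where "h \<in> H" "\<forall>x. \<phi> (h x) = Suc (\<phi> x) mod n"
      using homogeneous[OF loc_const_comp[OF \<phi>(1), of "\<lambda>i. Suc i mod n"] \<phi>(1)] by blast
    then have "h \<in> W1"
      unfolding W1_def using \<phi> by blast
    then show ?thesis by blast
  qed
  ultimately obtain x where x: "x \<in> H" "x \<circ> g \<circ> hinv x \<in> W1"
    using meets by blast
  have "openin T W2"
  proof (rule openin_homeoI)
    fix f assume "f \<in> W2"
    then obtain B where B: "clopen B" "prob B = w" "\<forall>x. f x \<in> B \<longleftrightarrow> x \<in> B"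
      unfolding W2_def by blast
    define \<kappa> where "\<kappa> x = (if x \<in> B then 1 else 0 :: nat)" for x
    have "loc_const \<kappa>"
      unfolding \<kappa>_def using loc_const_comp[OF B(1)[unfolded clopen_iff_loc_const], of "\<lambda>b. if b then 1 else 0"] .
    moreover have "f' \<in> W2" if "f' \<in> H" "\<forall>x. \<kappa> (f' x) = \<kappa> (f x)" for f'
    proof -
      have "f' x \<in> B \<longleftrightarrow> f x \<in> B" for x
        using that(2)[rule_format, of x] by (simp add: \<kappa>_def split: if_splits)
      then show ?thesis
        unfolding W2_def using B that by blast
    qed
    ultimately show "\<exists>\<kappa> :: cantor \<Rightarrow> nat. loc_const \<kappa> \<and> (\<forall>f'\<in>H. (\<forall>x. \<kappa> (f' x) = \<kappa> (f x)) \<longrightarrow> f' \<in> W2)"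
      by blast
  qed (auto simp: W2_def)
  \<comment> \<open>The identity preserves every clopen set, in particular one of measure
    \<open>w\<close>.\<close>
  moreover have "(\<lambda>x. x) \<in> W2"
    using w id_carrier by (auto simp: W2_def clopen_values_def)
  ultimately obtain y where y: "y \<in> H" "y \<circ> g \<circ> hinv y \<in> W2"
    using meets by blast
  obtain \<phi>0 :: "cantor \<Rightarrow> nat" where \<phi>0: "loc_const \<phi>0" "\<forall>z. \<phi>0 z < n"
    "\<forall>z. \<phi>0 ((x \<circ> g \<circ> hinv x) z) = Suc (\<phi>0 z) mod n"
    using x(2) unfolding W1_def by blast
  obtain B0 where B0: "clopen B0" "prob B0 = w" "\<forall>z. (y \<circ> g \<circ> hinv y) z \<in> B0 \<longleftrightarrow> z \<in> B0"
    using y(2) unfolding W2_def by blast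
  \<comment> \<open>The two conjugates of \<open>g\<close> differ; pulling the labelling back along
    \<open>x\<close> and the clopen set along \<open>y\<close> makes \<open>g\<close> itself rotate
    the one and fix the other.\<close>
  define \<phi> where "\<phi> z = \<phi>0 (x z)" for z
  define B where "B = y -` B0"
  have \<phi>: "loc_const \<phi>" "\<And>z. \<phi> z < n" "\<And>z. \<phi> (g z) = Suc (\<phi> z) mod n"
    using carrier_loc_const[OF x(1) \<phi>0(1)] \<phi>0(2,3)[rule_format, of "x z" for z] hinv_left[OF x(1)]
    by (simp_all add: \<phi>_def[abs_def])
  have B: "clopen B" "prob B = w" "\<And>z. g z \<in> B \<longleftrightarrow> z \<in> B"
    using carrier_loc_const[OF y(1) B0(1)[unfolded clopen_iff_loc_const]] carrier_prob[OF y(1) B0(1)]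
      B0(2) B0(3)[rule_format, of "y z" for z] hinv_left[OF y(1)]
    by (simp_all add: B_def clopen_iff_loc_const)
  have cl: "clopen (B \<inter> \<phi> -` {i})" for i
    using B(1) loc_const_clopen[OF \<phi>(1)] by (rule clopen_Int)
  have eq: "prob (B \<inter> \<phi> -` {i}) = prob (B \<inter> \<phi> -` {0})" if "i < n" for i
    using that
  proof (induction i)
    case (Suc i)
    \<comment> \<open>The wrap-around of the rotation produces only the label 0, so a positive label
      has the expected predecessor.\<close>
    have "\<phi> (g z) = Suc i \<longleftrightarrow> \<phi> z = i" for z
      using \<phi>(2)[of z] \<phi>(3)[of z] Suc.prems by (cases "Suc (\<phi> z) = n") auto
    then have "g -` (B \<inter> \<phi> -` {Suc i}) = B \<inter> \<phi> -` {i}"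
      using B(3) by auto
    then show ?case
      using carrier_prob[OF g(1) cl[of "Suc i"]] Suc by simp
  qed simp
  have "B = (\<Union>i\<in>{..<n}. B \<inter> \<phi> -` {i})"
    using \<phi>(2) by auto
  then have "w = prob (\<Union>i\<in>{..<n}. B \<inter> \<phi> -` {i})"
    using B(2) by simp
  also have "\<dots> = (\<Sum>i\<in>{..<n}. prob (B \<inter> \<phi> -` {i}))"
    by (rule finite_measure_finite_Union) (use cl in \<open>auto simp: clopen_measurable disjoint_family_on_def\<close>)
  also have "\<dots> = (\<Sum>i\<in>{..<n}. prob (B \<inter> \<phi> -` {0}))"
    by (rule sum.cong) (auto intro: eq)
  finally have "w / real n = prob (B \<inter> \<phi> -` {0})"
    using n(2) by simp
  then show ?thesis
    using cl unfolding clopen_values_def by blast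
qed

lemma dense_class_imp_subring:
  assumes rat: "clopen_values M \<subseteq> \<rat>" and g: "g \<in> H" "dense_in T (conjugacy_class G g)"
  shows "subring GV (ring_of_type_algebra :: real ring)"
  unfolding subring_iff
proof (intro ballI)
  fix u v assume uv: "u \<in> clopen_values M" "v \<in> clopen_values M"
  obtain m n :: nat where mn: "n \<noteq> 0" "u = real m / real n" "1 / real n \<in> clopen_values M"
    using V_fraction[OF uv(1)] rat uv(1) by blast
  have "v / real n \<in> GV"
    using GV_V[OF dense_class_imp_divisible[OF g mn(3,1) uv(2)]] .
  from GV_int_mult[OF this, of "int m"] show "u * v \<in> GV"
    by (simp add: mn(2))
qed

end

subsection \<open>Uniform partitions and their amalgamation\<close>

context good_cantor
begin

definition uniform :: "nat \<Rightarrow> (cantor \<Rightarrow> nat) \<Rightarrow> bool" where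
  "uniform N \<phi> \<longleftrightarrow> loc_const \<phi> \<and> (\<forall>x. \<phi> x < N) \<and> (\<forall>i<N. prob (\<phi> -` {i}) = 1 / real N)"

text \<open>Requiring \<open>permutes\<close> pins \<open>\<sigma>\<close> to the identity outside
  the labels, which leaves finitely many \<open>\<sigma>\<close> for each \<open>N\<close>.\<close>

definition acts :: "(cantor \<Rightarrow> cantor) \<Rightarrow> nat \<Rightarrow> (nat \<Rightarrow> nat) \<Rightarrow> (cantor \<Rightarrow> nat) \<Rightarrow> bool" where
  "acts f N \<sigma> \<phi> \<longleftrightarrow> uniform N \<phi> \<and> \<sigma> permutes {..<N} \<and> (\<forall>x. \<phi> (f x) = \<sigma> (\<phi> x))"

lemma uniform_pos: "uniform N \<phi> \<Longrightarrow> 0 < N"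
  unfolding uniform_def by (metis gr_zeroI less_nat_zero_code)

lemma uniform_onto:
  assumes "uniform N \<phi>" "i < N"
  shows "\<exists>x. \<phi> x = i"
proof -
  have "prob (\<phi> -` {i}) \<noteq> 0"
    using assms by (simp add: uniform_def)
  then have "i \<in> range \<phi>"
    using label_range_iff[of \<phi> i] assms by (simp add: uniform_def)
  then show ?thesis by auto
qed

lemma uniform_range: "uniform N \<phi> \<Longrightarrow> range \<phi> = {..<N}"
  using uniform_onto by (fastforce simp: uniform_def)

lemma uniform_value:
  assumes "uniform N \<phi>"
  shows "1 / real N \<in> clopen_values M"
proof -
  have "clopen (\<phi> -` {0})" "prob (\<phi> -` {0}) = 1 / real N"
    using assms uniform_pos[OF assms] loc_const_clopen by (auto simp: uniform_def)
  then show ?thesis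
    unfolding clopen_values_def by (metis (mono_tags, lifting) mem_Collect_eq)
qed

lemma prob_uniform:
  assumes "uniform N \<phi>"
  shows "prob (\<phi> -` A) = real (card {i. i < N \<and> i \<in> A}) / real N"
proof -
  have "prob (\<phi> -` A) = (\<Sum>i\<in>{..<N} \<inter> A. prob (\<phi> -` {i}))"
    using assms by (intro prob_label) (auto simp: uniform_def)
  also have "\<dots> = (\<Sum>i\<in>{..<N} \<inter> A. 1 / real N)"
    by (rule sum.cong) (use assms in \<open>auto simp: uniform_def\<close>)
  also have "{..<N} \<inter> A = {i. i < N \<and> i \<in> A}"
    by auto
  finally show ?thesis by simp
qed

text \<open>Cells of mass 1/N filling total mass 1 are exactly \<open>N\<close> in number, so a
  bijection onto \<open>{..<N}\<close> renames them and its inverse recovers the old labels.\<close>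

lemma uniform_relabel:
  fixes \<phi> :: "cantor \<Rightarrow> 'l"
  assumes lc: "loc_const \<phi>" and N: "0 < N" and mass: "\<And>x. prob (\<phi> -` {\<phi> x}) = 1 / real N"
  shows "\<exists>\<psi> r. uniform N \<psi> \<and> (\<forall>x. \<phi> x = r (\<psi> x))"
proof -
  have fin: "finite (range \<phi>)"
    using loc_const_finite[OF lc] .
  have "1 = prob (\<phi> -` UNIV)"
    by (simp add: prob_UNIV)
  also have "\<dots> = (\<Sum>i\<in>range \<phi> \<inter> UNIV. prob (\<phi> -` {i}))"
    by (rule prob_label[OF lc fin]) simp
  also have "\<dots> = (\<Sum>i\<in>range \<phi>. 1 / real N)"
    by (rule sum.cong) (use mass in auto)
  finally have "card (range \<phi>) = N"
    using N by simp
  then obtain e where e: "bij_betw e (range \<phi>) {..<N}"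
    using ex_bij_betw_finite_nat[OF fin] by (auto simp: lessThan_atLeast0)
  define \<psi> where "\<psi> x = e (\<phi> x)" for x
  have inj: "\<psi> x = \<psi> y \<longleftrightarrow> \<phi> x = \<phi> y" for x y
    using inj_on_eq_iff[OF bij_betw_imp_inj_on[OF e]] by (simp add: \<psi>_def)
  have "uniform N \<psi>"
    unfolding uniform_def
  proof (intro conjI allI impI)
    show "loc_const \<psi>"
      using loc_const_comp[OF lc, of e] by (simp add: \<psi>_def[abs_def])
    show "\<psi> x < N" for x
      using bij_betw_apply[OF e] by (auto simp: \<psi>_def)
    fix i assume "i < N"
    then obtain x where x: "i = \<psi> x"
      using bij_betw_imp_surj_on[OF e] unfolding \<psi>_def by (metis imageE lessThan_iff)
    have "\<psi> -` {i} = \<phi> -` {\<phi> x}"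
      using inj x by auto
    then show "prob (\<psi> -` {i}) = 1 / real N"
      using mass by simp
  qed
  moreover have "\<phi> x = inv_into (range \<phi>) e (\<psi> x)" for x
    using inv_into_f_f[OF bij_betw_imp_inj_on[OF e]] by (simp add: \<psi>_def)
  ultimately show ?thesis
    by blast
qed

end

section \<open>Approximation by permutations of uniform partitions\<close>

locale rational_ring_cantor = good_cantor +
  assumes rational: "clopen_values M \<subseteq> \<rat>"
    and V_mult_GV: "\<And>u v. u \<in> clopen_values M \<Longrightarrow> v \<in> clopen_values M \<Longrightarrow> u * v \<in> GV"
begin

lemma V_mult: "u \<in> clopen_values M \<Longrightarrow> v \<in> clopen_values M \<Longrightarrow> u * v \<in> clopen_values M"
  by (rule GV_unit[OF V_mult_GV]) (auto dest!: V_bounds intro: mult_le_one)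

text \<open>The product of the denominators serves: its reciprocal is a product of two values, hence
  a value.\<close>

lemma common_denominator:
  assumes "finite F" "F \<subseteq> clopen_values M"
  shows "\<exists>N>0. 1 / real N \<in> clopen_values M \<and> (\<forall>v\<in>F. \<exists>k::nat. v = real k / real N)"
  using assms
proof (induction F)
  case empty
  then show ?case using V_1 by (intro exI[of _ 1]) simp
next
  case (insert v F)
  then obtain N where N: "N > 0" "1 / real N \<in> clopen_values M" "\<forall>v\<in>F. \<exists>k::nat. v = real k / real N"
    by blast
  have "v \<in> clopen_values M" "v \<in> \<rat>"
    using insert.prems rational by auto
  then obtain m n :: nat where mn: "n \<noteq> 0" "v = real m / real n" "1 / real n \<in> clopen_values M"
    using V_fraction by blast
  have "\<exists>k::nat. u = real k / real (N * n)" if u: "u \<in> insert v F" for u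
  proof (cases "u = v")
    case True
    then have "u = real (m * N) / real (N * n)"
      using mn N by simp
    then show ?thesis by blast
  next
    case False
    then obtain k :: nat where "u = real k / real N"
      using N u by blast
    then have "u = real (k * n) / real (N * n)"
      using mn by simp
    then show ?thesis by blast
  qed
  moreover have "1 / real (N * n) \<in> clopen_values M"
    using V_mult[OF N(2) mn(3)] by simp
  ultimately show ?case
    using N(1) mn(1) by (intro exI[of _ "N * n"]) simp
qed

text \<open>A cell of mass k/N is cut into \<open>k\<close> cells of mass 1/N, which goodness
  permits because 1/N is a value.\<close>

lemma uniform_refinement:
  fixes \<Omega> :: "cantor \<Rightarrow> 'l"
  assumes lc: "loc_const \<Omega>"
  shows "\<exists>N \<rho> r. uniform N \<rho> \<and> (\<forall>x. \<Omega> x = r (\<rho> x))"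
proof -
  have cl: "clopen (\<Omega> -` {i})" for i
    using loc_const_clopen[OF lc] .
  have "finite ((\<lambda>i. prob (\<Omega> -` {i})) ` range \<Omega>)"
    using loc_const_finite[OF lc] by simp
  moreover have "(\<lambda>i. prob (\<Omega> -` {i})) ` range \<Omega> \<subseteq> clopen_values M"
    using cl by (auto simp: clopen_values_def)
  ultimately obtain N where N: "N > 0" "1 / real N \<in> clopen_values M"
    "\<forall>v\<in>(\<lambda>i. prob (\<Omega> -` {i})) ` range \<Omega>. \<exists>k::nat. v = real k / real N"
    using common_denominator[of "(\<lambda>i. prob (\<Omega> -` {i})) ` range \<Omega>"] by blast
  have "\<exists>\<delta> :: cantor \<Rightarrow> nat. loc_const \<delta> \<and>
      (\<forall>x. \<Omega> x = i \<longrightarrow> prob (\<Omega> -` {i} \<inter> \<delta> -` {\<delta> x}) = 1 / real N)" for i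
  proof (cases "i \<in> range \<Omega>")
    case True
    then obtain k :: nat where k: "prob (\<Omega> -` {i}) = real k / real N"
      using N(3) by blast
    have "\<exists>\<delta>. loc_const \<delta> \<and> (\<forall>x\<in>\<Omega> -` {i}. \<delta> x \<in> {..<k}) \<and>
        (\<forall>j\<in>{..<k}. prob (\<Omega> -` {i} \<inter> \<delta> -` {j}) = 1 / real N)"
      by (rule label_split) (use cl N k in auto)
    then obtain \<delta> where \<delta>: "loc_const \<delta>" "\<forall>x\<in>\<Omega> -` {i}. \<delta> x \<in> {..<k}"
      "\<forall>j\<in>{..<k}. prob (\<Omega> -` {i} \<inter> \<delta> -` {j}) = 1 / real N"
      by blast
    show ?thesis
      by (rule exI[of _ \<delta>]) (use \<delta> in auto)
  next
    case False
    then show ?thesis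
      using loc_const_const[of "0 :: nat"] by (intro exI[of _ "\<lambda>_. 0"]) auto
  qed
  then have "\<forall>i. \<exists>\<delta> :: cantor \<Rightarrow> nat. loc_const \<delta> \<and>
      (\<forall>x. \<Omega> x = i \<longrightarrow> prob (\<Omega> -` {i} \<inter> \<delta> -` {\<delta> x}) = 1 / real N)" ..
  from choice[OF this] obtain \<delta> :: "'l \<Rightarrow> cantor \<Rightarrow> nat" where \<delta>: "\<forall>i. loc_const (\<delta> i) \<and>
      (\<forall>x. \<Omega> x = i \<longrightarrow> prob (\<Omega> -` {i} \<inter> \<delta> i -` {\<delta> i x}) = 1 / real N)" ..
  define \<rho> where "\<rho> x = (\<Omega> x, \<delta> (\<Omega> x) x)" for x
  have "loc_const \<rho>"
    unfolding \<rho>_def[abs_def] using \<delta> by (intro loc_const_Pair[OF lc loc_const_glue[OF lc]]) blast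
  moreover have "prob (\<rho> -` {\<rho> x}) = 1 / real N" for x
  proof -
    have "\<rho> -` {\<rho> x} = \<Omega> -` {\<Omega> x} \<inter> \<delta> (\<Omega> x) -` {\<delta> (\<Omega> x) x}"
      by (auto simp: \<rho>_def)
    then show ?thesis
      using \<delta> by simp
  qed
  ultimately obtain \<psi> r where \<psi>: "uniform N \<psi>" "\<forall>x. \<rho> x = r (\<psi> x)"
    using uniform_relabel[OF _ N(1), of \<rho>] by blast
  have "\<Omega> x = fst (r (\<psi> x))" for x
    using \<psi>(2)[rule_format, of x] by (metis \<rho>_def fst_conv)
  then show ?thesis
    using \<psi>(1) by (intro exI[of _ N] exI[of _ \<psi>] exI[of _ "\<lambda>i. fst (r i)"]) simp
qed

text \<open>Measure preservation becomes counting: \<open>t\<close> and \<open>s\<close> take each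
  label on equally many atoms. So they have the same multiset of values and differ by a permutation
  of the atoms.\<close>

lemma uniform_permutation:
  assumes f: "f \<in> H" and \<kappa>: "loc_const \<kappa>" and \<rho>: "uniform N \<rho>"
    and s: "\<And>x. \<kappa> x = s (\<rho> x)" and t: "\<And>x. \<kappa> (f x) = t (\<rho> x)"
  shows "\<exists>\<theta>. \<theta> permutes {..<N} \<and> (\<forall>i<N. t i = s (\<theta> i))"
proof -
  have "card {i \<in> {..<N}. t i = l} = card {i \<in> {..<N}. s i = l}" for l
  proof -
    have "(\<lambda>x. \<kappa> x) -` {l} = \<rho> -` {i. s i = l}" "f -` (\<kappa> -` {l}) = \<rho> -` {i. t i = l}"
      using s t by auto
    then have "prob (\<rho> -` {i. t i = l}) = prob (\<rho> -` {i. s i = l})"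
      using carrier_prob[OF f loc_const_clopen[OF \<kappa>], of "{l}"] by simp
    then show ?thesis
      using uniform_pos[OF \<rho>] unfolding prob_uniform[OF \<rho>] by simp
  qed
  then have "image_mset t (mset_set {..<N}) = image_mset s (mset_set {..<N})"
    by (intro multiset_eqI) (simp add: count_image_mset_eq_card_vimage)
  then obtain \<theta> where "\<theta> permutes {..<N}" "\<forall>i\<in>{..<N}. t i = s (\<theta> i)"
    using image_mset_eq_implies_permutes[of "{..<N}" t s] by blast
  then show ?thesis
    by auto
qed

lemma uniform_realize:
  assumes \<rho>: "uniform N \<rho>" and \<theta>: "\<theta> permutes {..<N}"
  shows "\<exists>f\<in>H. acts f N \<theta> \<rho>"
proof -
  have "{j. j < N \<and> j \<in> {i}} = (if i < N then {i} else {})" for i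
    by auto
  then have "prob (\<rho> -` {i}) = (if i < N then 1 / real N else 0)" for i
    unfolding prob_uniform[OF \<rho>] by simp
  moreover have "\<theta> i < N \<longleftrightarrow> i < N" for i
    using permutes_in_image[OF \<theta>, of i] by simp
  ultimately have "prob (\<rho> -` {\<theta> i}) = prob (\<rho> -` {i})" for i
    by simp
  then have "\<exists>f\<in>H. \<forall>x. \<rho> (f x) = \<theta> (\<rho> x)"
    using \<rho> permutes_bij[OF \<theta>] by (intro permuting_homeo) (auto simp: uniform_def)
  then show ?thesis
    using \<rho> \<theta> by (auto simp: acts_def)
qed

text \<open>Refine \<open>\<kappa>\<close> and \<open>\<kappa> \<circ> f\<close> jointly. An atom
  only has to go to some atom whose \<open>\<kappa>\<close>-label is the one prescribed by
  \<open>f\<close>, and a permutation achieving this is realised by homogeneity.\<close>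

lemma approximation:
  assumes f: "f \<in> H" and \<kappa>: "loc_const \<kappa>"
  shows "\<exists>f1\<in>H. \<exists>N \<theta> \<rho> r. acts f1 N \<theta> \<rho> \<and> (\<forall>x. \<kappa> (f1 x) = \<kappa> (f x)) \<and> (\<forall>x. \<kappa> x = r (\<rho> x))"
proof -
  obtain N \<rho> r where \<rho>: "uniform N \<rho>" "\<forall>x. (\<kappa> x, \<kappa> (f x)) = r (\<rho> x)"
    using uniform_refinement[OF loc_const_Pair[OF \<kappa> carrier_loc_const[OF f \<kappa>]]] by blast
  have st: "\<kappa> x = fst (r (\<rho> x))" "\<kappa> (f x) = snd (r (\<rho> x))" for x
    using \<rho>(2)[rule_format, of x, symmetric] by simp_all
  obtain \<theta> where \<theta>: "\<theta> permutes {..<N}" "\<forall>i<N. snd (r i) = fst (r (\<theta> i))"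
    using uniform_permutation[OF f \<kappa> \<rho>(1) st] by blast
  obtain f1 where f1: "f1 \<in> H" "acts f1 N \<theta> \<rho>"
    using uniform_realize[OF \<rho>(1) \<theta>(1)] by blast
  have "\<kappa> (f1 x) = \<kappa> (f x)" for x
  proof -
    have "\<kappa> (f1 x) = fst (r (\<theta> (\<rho> x)))"
      using st(1)[of "f1 x"] f1(2) by (simp add: acts_def)
    also have "\<dots> = snd (r (\<rho> x))"
      using \<theta>(2) \<rho>(1) by (simp add: uniform_def)
    finally show ?thesis
      by (simp only: st(2))
  qed
  then show ?thesis
    using f1 st(1) by (intro bexI[of _ f1] exI[of _ N] exI[of _ \<theta>] exI[of _ \<rho>] exI[of _ "\<lambda>i. fst (r i)"]) simp_all
qed

text \<open>The last clause says that all fibres of \<open>\<pi>\<close> have size N/n, so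
  \<open>\<pi>\<close> carries uniform measure to uniform measure; it is multiplied out to avoid
  division in \<open>nat\<close>. Extensionality of \<open>\<pi>\<close> leaves finitely many
  extensions for each \<open>n\<close> and \<open>N\<close>.\<close>

definition extension :: "nat \<Rightarrow> (nat \<Rightarrow> nat) \<Rightarrow> nat \<Rightarrow> (nat \<Rightarrow> nat) \<Rightarrow> (nat \<Rightarrow> nat) \<Rightarrow> bool" where
  "extension n \<sigma> N \<tau> \<pi> \<longleftrightarrow> 0 < N \<and> 1 / real N \<in> clopen_values M \<and>
     \<sigma> permutes {..<n} \<and> \<tau> permutes {..<N} \<and> \<pi> \<in> {..<N} \<rightarrow>\<^sub>E {..<n} \<and>
     (\<forall>b<N. \<pi> (\<tau> b) = \<sigma> (\<pi> b)) \<and> (\<forall>a<n. n * card {b. b < N \<and> \<pi> b = a} = N)"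

text \<open>The atoms of the fibre product of \<open>\<rho>\<close> and the extension are the pairs \<open>(a, b)\<close> with
  \<open>q a = \<pi> b\<close>; each gets measure \<open>1/(K m)\<close>, where \<open>m\<close> is the size of the fibres of \<open>\<pi>\<close>.\<close>

lemma amalgamation:
  assumes f: "f \<in> H" "acts f n \<sigma> \<phi>" and ext: "extension n \<sigma> N \<tau> \<pi>" and \<kappa>: "loc_const \<kappa>"
  shows "\<exists>f2\<in>H. \<exists>\<psi>. acts f2 N \<tau> \<psi> \<and> (\<forall>x. \<pi> (\<psi> x) = \<phi> x) \<and> (\<forall>x. \<kappa> (f2 x) = \<kappa> (f x))"
proof -
  have \<phi>: "uniform n \<phi>" "\<And>x. \<phi> (f x) = \<sigma> (\<phi> x)" "\<And>x. \<phi> x < n" "loc_const \<phi>"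
    using f(2) by (auto simp: acts_def uniform_def)
  have N: "0 < N" "1 / real N \<in> clopen_values M" "\<sigma> permutes {..<n}" "\<tau> permutes {..<N}"
    "\<And>b. b < N \<Longrightarrow> \<pi> b < n" "\<And>b. b < N \<Longrightarrow> \<pi> (\<tau> b) = \<sigma> (\<pi> b)"
    "\<And>a. a < n \<Longrightarrow> n * card {b. b < N \<and> \<pi> b = a} = N"
    using ext by (auto simp: extension_def)
  have n: "0 < n"
    using uniform_pos[OF \<phi>(1)] .
  define m where "m = card {b. b < N \<and> \<pi> b = 0}"
  have m: "N = n * m" "0 < m"
    using N(7)[OF n] N(1) by (auto simp: m_def intro: gr0I)
  have card_m: "card {b. b < N \<and> \<pi> b = a} = m" if "a < n" for a
    using N(7)[OF that] m(1) n by simp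
  \<comment> \<open>Approximating for \<open>\<kappa>\<close> and \<open>\<phi>\<close> jointly
    keeps the action on \<open>\<phi>\<close>, so that the atoms of \<open>\<rho>\<close> map
    equivariantly to those of \<open>\<phi>\<close> through \<open>q\<close>.\<close>
  obtain f1 K \<theta> \<rho> r where f1: "f1 \<in> H" "acts f1 K \<theta> \<rho>" "\<forall>x. (\<kappa> (f1 x), \<phi> (f1 x)) = (\<kappa> (f x), \<phi> (f x))"
    "\<forall>x. (\<kappa> x, \<phi> x) = r (\<rho> x)"
    using approximation[OF f(1) loc_const_Pair[OF \<kappa> \<phi>(4)]] by blast
  have \<rho>: "uniform K \<rho>" "\<theta> permutes {..<K}" "\<And>x. \<rho> (f1 x) = \<theta> (\<rho> x)" "loc_const \<rho>" "\<And>x. \<rho> x < K"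
    using f1(2) by (auto simp: acts_def uniform_def)
  have K: "0 < K"
    using uniform_pos[OF \<rho>(1)] .
  define p where "p a = fst (r a)" for a
  define q where "q a = snd (r a)" for a
  have pq: "\<kappa> x = p (\<rho> x)" "\<phi> x = q (\<rho> x)" for x
    using f1(4)[rule_format, of x, symmetric] by (simp_all add: p_def q_def)
  have q: "q a < n" "q (\<theta> a) = \<sigma> (q a)" if a: "a < K" for a
  proof -
    obtain x where x: "\<rho> x = a"
      using uniform_onto[OF \<rho>(1) a] by blast
    show "q a < n"
      using \<phi>(3)[of x] pq(2)[of x] x by simp
    have "q (\<theta> a) = \<phi> (f1 x)"
      by (simp add: pq(2) \<rho>(3) x)
    also have "\<dots> = \<sigma> (\<phi> x)"
      using f1(3) \<phi>(2) by simp
    finally show "q (\<theta> a) = \<sigma> (q a)"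
      by (simp add: pq(2) x)
  qed
  \<comment> \<open>The group property suffices for 1/m; multiplying it by 1/K below is where the
    ring property enters.\<close>
  have "1 / real m = real_of_int (int n) * (1 / real N)"
    using n m by simp
  then have "1 / real m \<in> GV"
    using GV_int_mult[OF GV_V[OF N(2)], of "int n"] by simp
  then have "1 / real m \<in> clopen_values M"
    using m(2) by (intro GV_unit) auto
  from V_mult[OF uniform_value[OF \<rho>(1)] this] have Km: "1 / real (K * m) \<in> clopen_values M"
    by simp
  have "\<exists>\<delta>. loc_const \<delta> \<and> (a < K \<longrightarrow> (\<forall>x\<in>\<rho> -` {a}. \<delta> x \<in> {b. b < N \<and> \<pi> b = q a}) \<and>
      (\<forall>b\<in>{b. b < N \<and> \<pi> b = q a}. prob (\<rho> -` {a} \<inter> \<delta> -` {b}) = 1 / real (K * m)))" for a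
  proof (cases "a < K")
    case True
    have "\<exists>\<delta>. loc_const \<delta> \<and> (\<forall>x\<in>\<rho> -` {a}. \<delta> x \<in> {b. b < N \<and> \<pi> b = q a}) \<and>
      (\<forall>b\<in>{b. b < N \<and> \<pi> b = q a}. prob (\<rho> -` {a} \<inter> \<delta> -` {b}) = 1 / real (K * m))"
    proof (rule label_split)
      show "clopen (\<rho> -` {a})"
        using loc_const_clopen[OF \<rho>(4)] .
      show "(\<Sum>b\<in>{b. b < N \<and> \<pi> b = q a}. 1 / real (K * m)) = prob (\<rho> -` {a})"
        using card_m[OF q(1)[OF True]] m(2) \<rho>(1) True by (simp add: uniform_def)
    qed (use Km in auto)
    then show ?thesis by blast
  next
    case False
    then show ?thesis
      using loc_const_const[of "0 :: nat"] by (intro exI[of _ "\<lambda>_. 0"]) simp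
  qed
  then have "\<forall>a. \<exists>\<delta>. loc_const \<delta> \<and> (a < K \<longrightarrow> (\<forall>x\<in>\<rho> -` {a}. \<delta> x \<in> {b. b < N \<and> \<pi> b = q a}) \<and>
      (\<forall>b\<in>{b. b < N \<and> \<pi> b = q a}. prob (\<rho> -` {a} \<inter> \<delta> -` {b}) = 1 / real (K * m)))" ..
  from choice[OF this] obtain \<delta> where \<delta>0: "\<forall>a. loc_const (\<delta> a) \<and>
      (a < K \<longrightarrow> (\<forall>x\<in>\<rho> -` {a}. \<delta> a x \<in> {b. b < N \<and> \<pi> b = q a}) \<and>
      (\<forall>b\<in>{b. b < N \<and> \<pi> b = q a}. prob (\<rho> -` {a} \<inter> \<delta> a -` {b}) = 1 / real (K * m)))" ..
  define \<psi> where "\<psi> x = \<delta> (\<rho> x) x" for x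
  have \<psi>_lc: "loc_const \<psi>"
    unfolding \<psi>_def[abs_def] using loc_const_glue[OF \<rho>(4), of \<delta>] \<delta>0 by blast
  have \<psi>: "\<psi> x < N" "\<pi> (\<psi> x) = q (\<rho> x)" for x
    using \<delta>0[rule_format, of "\<rho> x"] \<rho>(5)[of x] by (auto simp: \<psi>_def)
  define \<rho>' where "\<rho>' x = (\<rho> x, \<psi> x)" for x
  have \<rho>'_lc: "loc_const \<rho>'"
    unfolding \<rho>'_def[abs_def] using loc_const_Pair[OF \<rho>(4) \<psi>_lc] .
  have mass: "prob (\<rho>' -` {(a, b)}) = (if a < K \<and> b < N \<and> \<pi> b = q a then 1 / real (K * m) else 0)" for a b
  proof (cases "a < K \<and> b < N \<and> \<pi> b = q a")
    case True
    have "\<rho>' -` {(a, b)} = \<rho> -` {a} \<inter> \<delta> a -` {b}"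
      by (auto simp: \<rho>'_def \<psi>_def)
    then show ?thesis
      using \<delta>0[rule_format, of a] True by simp
  next
    case False
    then have "\<rho>' -` {(a, b)} = {}"
      using \<psi> \<rho>(5) by (auto simp: \<rho>'_def)
    then show ?thesis
      using False by auto
  qed
  have "\<exists>h\<in>H. \<forall>x. \<rho>' (h x) = map_prod \<theta> \<tau> (\<rho>' x)"
  proof (rule permuting_homeo[OF \<rho>'_lc])
    have "bij \<theta>" "bij \<tau>"
      using permutes_bij \<rho>(2) N(4) by blast+
    then show "bij (map_prod \<theta> \<tau>)"
      using bij_betw_map_prod[of \<theta> UNIV UNIV \<tau> UNIV UNIV] by simp
    fix z :: "nat \<times> nat"
    obtain a b where z: "z = (a, b)"
      by (cases z)
    have "\<theta> a < K \<longleftrightarrow> a < K" "\<tau> b < N \<longleftrightarrow> b < N"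
      using permutes_in_image[OF \<rho>(2), of a] permutes_in_image[OF N(4), of b] by auto
    \<comment> \<open>Both \<open>q\<close> and \<open>\<pi>\<close> are equivariant over the
      injective map \<open>\<sigma>\<close>, so the pair of permutations preserves the fibre
      product.\<close>
    moreover have "\<pi> (\<tau> b) = q (\<theta> a) \<longleftrightarrow> \<pi> b = q a" if "a < K" "b < N"
      using q(2)[OF that(1)] N(6)[OF that(2)] inj_eq[OF permutes_inj[OF N(3)]] by simp
    ultimately show "prob (\<rho>' -` {map_prod \<theta> \<tau> z}) = prob (\<rho>' -` {z})"
      unfolding z map_prod_simp mass by auto
  qed
  then obtain f2 where f2: "f2 \<in> H" "\<And>x. \<rho> (f2 x) = \<theta> (\<rho> x)" "\<And>x. \<psi> (f2 x) = \<tau> (\<psi> x)"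
    by (auto simp: \<rho>'_def)
  have "prob (\<psi> -` {b}) = 1 / real N" if b: "b < N" for b
  proof -
    \<comment> \<open>Of the atoms of \<open>\<rho>\<close>, K/n lie over a given label of
      \<open>\<phi>\<close>; a cell of \<open>\<psi>\<close> thus has mass (K/n) / (K m) =
      1/N.\<close>
    have "real (card {a. a < K \<and> q a = \<pi> b}) / real K = 1 / real n"
    proof -
      have "real (card {a. a < K \<and> q a = \<pi> b}) / real K = prob (\<rho> -` {a. q a = \<pi> b})"
        by (simp only: prob_uniform[OF \<rho>(1)] mem_Collect_eq)
      also have "\<rho> -` {a. q a = \<pi> b} = \<phi> -` {\<pi> b}"
        using pq(2) by auto
      also have "prob \<dots> = 1 / real n"
        using \<phi>(1) N(5)[OF b] by (simp add: uniform_def)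
      finally show ?thesis .
    qed
    moreover have "prob (\<psi> -` {b}) = real (card {a. a < K \<and> q a = \<pi> b}) / real (K * m)"
    proof -
      have "\<psi> -` {b} = (\<Union>a\<in>{a. a < K \<and> q a = \<pi> b}. \<rho>' -` {(a, b)})"
        using \<psi>(2) \<rho>(5) by (auto simp: \<rho>'_def)
      also have "prob \<dots> = (\<Sum>a\<in>{a. a < K \<and> q a = \<pi> b}. prob (\<rho>' -` {(a, b)}))"
        by (rule finite_measure_finite_Union)
          (use loc_const_measurable[OF \<rho>'_lc] in \<open>auto simp: disjoint_family_on_def\<close>)
      also have "\<dots> = (\<Sum>a\<in>{a. a < K \<and> q a = \<pi> b}. 1 / real (K * m))"
        by (rule sum.cong) (use b in \<open>auto simp: mass\<close>)
      finally show ?thesis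
        by simp
    qed
    ultimately have "prob (\<psi> -` {b}) = (1 / real n) / real m"
      by (simp only: of_nat_mult divide_divide_eq_left[symmetric])
    then show ?thesis
      by (simp add: m(1))
  qed
  then have "acts f2 N \<tau> \<psi>"
    unfolding acts_def uniform_def using \<psi>_lc \<psi>(1) N(4) f2(3) by blast
  moreover have "\<kappa> (f2 x) = \<kappa> (f x)" for x
  proof -
    have "\<kappa> (f2 x) = p (\<rho> (f1 x))"
      by (simp add: pq(1) f2(2) \<rho>(3))
    also have "\<dots> = \<kappa> (f x)"
      using f1(3) pq(1)[of "f1 x"] by simp
    finally show ?thesis .
  qed
  moreover have "\<pi> (\<psi> x) = \<phi> x" for x
    by (simp add: \<psi>(2) pq(2))
  ultimately show ?thesis
    using f2(1) by blast
qed

end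

subsection \<open>The generic conjugacy class\<close>

context good_cantor
begin

lemma nowhere_dense_complement:
  assumes D: "openin T D" and meets: "\<And>W. openin T W \<Longrightarrow> W \<noteq> {} \<Longrightarrow> D \<inter> W \<noteq> {}"
  shows "nowhere_dense_in T (topspace T - D)"
proof -
  have "closedin T (topspace T - D)"
    using D by (rule openin_closedin_eq[THEN iffD1, THEN conjunct2])
  then have "Abstract_Topology.closure_of T (topspace T - D) = topspace T - D"
    by (simp add: closure_of_closedin)
  moreover have "T interior_of (topspace T - D) = {}"
    using meets[of "T interior_of (topspace T - D)"] interior_of_subset[of T "topspace T - D"] by auto
  ultimately show ?thesis
    by (simp add: nowhere_dense_in_def)
qed

lemma nowhere_dense_subset:
  assumes "nowhere_dense_in T N" "N' \<subseteq> N"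
  shows "nowhere_dense_in T N'"
proof -
  have "T interior_of (Abstract_Topology.closure_of T N') \<subseteq> T interior_of (Abstract_Topology.closure_of T N)"
    by (rule interior_of_mono[OF closure_of_mono[OF assms(2)]])
  then show ?thesis
    using assms unfolding nowhere_dense_in_def by blast
qed

text \<open>The Baire property provides a map in all members of \<open>F\<close>, and
  \<open>conj\<close> puts every other such map into its class; the complement of the class is then
  covered by the complements of the dense open sets.\<close>

lemma comeager_class:
  assumes cF: "countable F" and op: "\<And>D. D \<in> F \<Longrightarrow> openin T D"
    and dense: "\<And>D f n. D \<in> F \<Longrightarrow> f \<in> H \<Longrightarrow> \<exists>f'\<in>D. \<forall>x. cyl n (f' x) = cyl n (f x)"
    and conj: "\<And>f f'. f \<in> H \<Longrightarrow> f' \<in> H \<Longrightarrow> \<forall>D\<in>F. f \<in> D \<Longrightarrow> \<forall>D\<in>F. f' \<in> D \<Longrightarrow>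
      \<exists>h\<in>H. \<forall>x. h (f x) = f' (h x)"
  shows "\<exists>g\<in>H. comeager_in T (conjugacy_class G g)"
proof -
  have DH: "D \<subseteq> H" if "D \<in> F" for D
    using op[OF that] by (simp add: openin_homeo_iff)
  have nd: "nowhere_dense_in T (topspace T - D)" if D: "D \<in> F" for D
  proof (rule nowhere_dense_complement[OF op[OF D]])
    fix W assume W: "openin T W" "W \<noteq> {}"
    then obtain f n where f: "f \<in> W" "f \<in> H" "\<forall>f'\<in>H. (\<forall>x. cyl n (f' x) = cyl n (f x)) \<longrightarrow> f' \<in> W"
      unfolding openin_homeo_iff by blast
    obtain f' where f': "f' \<in> D" "\<forall>x. cyl n (f' x) = cyl n (f x)"
      using dense[OF D f(2)] by blast
    then have "f' \<in> W"
      using f(3) DH[OF D] by blast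
    then show "D \<inter> W \<noteq> {}"
      using f'(1) by blast
  qed
  have top: "topspace T = H"
    by (rule topspace_homeo_topology)
  have "\<exists>g\<in>topspace T. g \<notin> \<Union>((\<lambda>D. topspace T - D) ` F)"
  proof (rule baire)
    show "topspace T \<noteq> {}"
      unfolding top using id_carrier by blast
  qed (use cF nd in auto)
  then obtain g where g: "g \<in> H" "\<forall>D\<in>F. g \<in> D"
    unfolding top by blast
  define C where "C = conjugacy_class G g"
  have C_H: "C \<subseteq> H"
    unfolding C_def conjugacy_class_eq using comp_carrier hinv_carrier g(1) by blast
  have in_C: "f \<in> C" if f: "f \<in> H" "\<forall>D\<in>F. f \<in> D" for f
  proof -
    obtain h where h: "h \<in> H" "\<forall>x. h (g x) = f (h x)"
      using conj[OF g(1) f(1) g(2) f(2)] by blast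
    have "f = h \<circ> g \<circ> hinv h"
    proof
      fix x
      show "f x = (h \<circ> g \<circ> hinv h) x"
        using h(2)[rule_format, of "hinv h x"] by (simp add: hinv_right[OF h(1)])
    qed
    then show ?thesis
      unfolding C_def conjugacy_class_eq using h(1) by blast
  qed
  have "meager_in T (topspace T - C)"
    unfolding meager_in_def
  proof (intro exI conjI ballI)
    \<comment> \<open>\<open>meager_in\<close> asks for an equality, so each nowhere dense set is
      cut down to the complement of \<open>C\<close>.\<close>
    show "countable ((\<lambda>D. (topspace T - C) \<inter> (topspace T - D)) ` F)"
      using cF by simp
    show "topspace T - C = \<Union>((\<lambda>D. (topspace T - C) \<inter> (topspace T - D)) ` F)"
      unfolding top using in_C by blast
    fix N assume "N \<in> (\<lambda>D. (topspace T - C) \<inter> (topspace T - D)) ` F"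
    then obtain D where D: "D \<in> F" "N = (topspace T - C) \<inter> (topspace T - D)"
      by blast
    show "nowhere_dense_in T N"
      unfolding D(2) by (rule nowhere_dense_subset[OF nd[OF D(1)]]) blast
  qed
  then show ?thesis
    using g(1) C_H unfolding comeager_in_def top C_def by blast
qed

end

section \<open>Generic homeomorphisms and their conjugacy\<close>

context rational_ring_cantor
begin

definition periodic_at :: "nat \<Rightarrow> (cantor \<Rightarrow> cantor) set" where
  "periodic_at k = {f \<in> H. \<exists>N \<theta> \<rho> r. acts f N \<theta> \<rho> \<and> (\<forall>x. cyl k x = r (\<rho> x))}"

text \<open>The implication serves density and openness at once: a map that fails to act on
  \<open>\<phi>\<close> belongs to the set, and so does every map in the group sending points to the
  same \<open>\<phi>\<close>-labels.\<close>

definition realizing ::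
  "(cantor \<Rightarrow> nat) \<Rightarrow> nat \<Rightarrow> (nat \<Rightarrow> nat) \<Rightarrow> nat \<Rightarrow> (nat \<Rightarrow> nat) \<Rightarrow> (nat \<Rightarrow> nat) \<Rightarrow> (cantor \<Rightarrow> cantor) set" where
  "realizing \<phi> n \<sigma> N \<tau> \<pi> =
    {f \<in> H. acts f n \<sigma> \<phi> \<longrightarrow> (\<exists>\<psi>. acts f N \<tau> \<psi> \<and> (\<forall>x. \<pi> (\<psi> x) = \<phi> x))}"

lemma acts_cong: "acts f N \<sigma> \<phi> \<Longrightarrow> \<forall>x. \<phi> (f' x) = \<phi> (f x) \<Longrightarrow> acts f' N \<sigma> \<phi>"
  by (simp add: acts_def)

lemma acts_loc_const: "acts f N \<sigma> \<phi> \<Longrightarrow> loc_const \<phi>"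
  by (simp add: acts_def uniform_def)

lemma open_periodic_at: "openin T (periodic_at k)"
proof (rule openin_homeoI)
  fix f assume "f \<in> periodic_at k"
  then obtain N \<theta> \<rho> r where *: "acts f N \<theta> \<rho>" "\<forall>x. cyl k x = r (\<rho> x)"
    unfolding periodic_at_def by blast
  have "f' \<in> periodic_at k" if "f' \<in> H" "\<forall>x. \<rho> (f' x) = \<rho> (f x)" for f'
    unfolding periodic_at_def using acts_cong[OF *(1) that(2)] *(2) that(1) by blast
  then show "\<exists>\<kappa> :: cantor \<Rightarrow> nat. loc_const \<kappa> \<and>
      (\<forall>f'\<in>H. (\<forall>x. \<kappa> (f' x) = \<kappa> (f x)) \<longrightarrow> f' \<in> periodic_at k)"
    using acts_loc_const[OF *(1)] by blast
qed (simp add: periodic_at_def)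

lemma open_realizing:
  assumes \<phi>: "loc_const \<phi>"
  shows "openin T (realizing \<phi> n \<sigma> N \<tau> \<pi>)"
proof (rule openin_homeoI)
  fix f assume f: "f \<in> realizing \<phi> n \<sigma> N \<tau> \<pi>"
  show "\<exists>\<kappa> :: cantor \<Rightarrow> nat. loc_const \<kappa> \<and>
      (\<forall>f'\<in>H. (\<forall>x. \<kappa> (f' x) = \<kappa> (f x)) \<longrightarrow> f' \<in> realizing \<phi> n \<sigma> N \<tau> \<pi>)"
  proof (cases "acts f n \<sigma> \<phi>")
    case True
    then obtain \<psi> where \<psi>: "acts f N \<tau> \<psi>" "\<forall>x. \<pi> (\<psi> x) = \<phi> x"
      using f unfolding realizing_def by blast
    have "f' \<in> realizing \<phi> n \<sigma> N \<tau> \<pi>" if "f' \<in> H" "\<forall>x. \<psi> (f' x) = \<psi> (f x)" for f'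
      unfolding realizing_def using acts_cong[OF \<psi>(1) that(2)] \<psi>(2) that(1) by blast
    then show ?thesis
      using acts_loc_const[OF \<psi>(1)] by blast
  next
    case False
    have "f' \<in> realizing \<phi> n \<sigma> N \<tau> \<pi>" if f': "f' \<in> H" "\<forall>x. \<phi> (f' x) = \<phi> (f x)" for f'
    proof -
      have "\<not> acts f' n \<sigma> \<phi>"
        using acts_cong[of f' n \<sigma> \<phi> f] f'(2) False by auto
      then show ?thesis
        using f'(1) by (simp add: realizing_def)
    qed
    then show ?thesis
      using \<phi> by blast
  qed
qed (simp add: realizing_def)

text \<open>One label of the approximated pair keeps the new map close to \<open>f\<close>, the
  other makes the permuted partition fine enough for depth \<open>k\<close>.\<close>

lemma dense_periodic_at:
  assumes "f \<in> H"
  shows "\<exists>f'\<in>periodic_at k. \<forall>x. cyl n (f' x) = cyl n (f x)"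
proof -
  obtain f1 N \<theta> \<rho> r where *: "f1 \<in> H" "acts f1 N \<theta> \<rho>"
    "\<forall>x. (cyl n (f1 x), cyl k (f1 x)) = (cyl n (f x), cyl k (f x))" "\<forall>x. (cyl n x, cyl k x) = r (\<rho> x)"
    using approximation[OF assms loc_const_Pair[OF loc_const_cyl[of n] loc_const_cyl[of k]]] by blast
  have "cyl k x = snd (r (\<rho> x))" for x
    using *(4)[rule_format, of x, symmetric] by simp
  then have "f1 \<in> periodic_at k"
    unfolding periodic_at_def mem_Collect_eq
    by (intro conjI exI[of _ N] exI[of _ \<theta>] exI[of _ \<rho>] exI[of _ "\<lambda>i. snd (r i)"] allI *(1,2))
  then show ?thesis
    using *(3) by (intro bexI[of _ f1]) simp_all
qed

lemma dense_realizing: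
  assumes ext: "extension n \<sigma> N \<tau> \<pi>" and f: "f \<in> H"
  shows "\<exists>f'\<in>realizing \<phi> n \<sigma> N \<tau> \<pi>. \<forall>x. cyl m (f' x) = cyl m (f x)"
proof (cases "acts f n \<sigma> \<phi>")
  case True
  obtain f2 \<psi> where "f2 \<in> H" "acts f2 N \<tau> \<psi>" "\<forall>x. \<pi> (\<psi> x) = \<phi> x" "\<forall>x. cyl m (f2 x) = cyl m (f x)"
    using amalgamation[OF f True ext loc_const_cyl] by blast
  then show ?thesis
    by (intro bexI[of _ f2]) (auto simp: realizing_def)
next
  case False
  then show ?thesis
    using f by (intro bexI[of _ f]) (simp_all add: realizing_def)
qed

definition generic_family :: "(cantor \<Rightarrow> cantor) set set" where
  "generic_family = range periodic_at \<union>
    {realizing \<phi> n \<sigma> N \<tau> \<pi> | \<phi> n \<sigma> N \<tau> \<pi>. loc_const \<phi> \<and> extension n \<sigma> N \<tau> \<pi>}"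

lemma countable_generic_family: "countable generic_family"
proof -
  define J where "J n N = {n} \<times> {\<sigma>. \<sigma> permutes {..<n}} \<times> {N} \<times> {\<tau>. \<tau> permutes {..<N}} \<times> ({..<N} \<rightarrow>\<^sub>E {..<n})"
    for n N :: nat
  define I where "I = {\<phi> :: cantor \<Rightarrow> nat. loc_const \<phi>} \<times> (\<Union>n N. J n N)"
  have "finite (J n N)" for n N
    unfolding J_def
    by (intro finite_cartesian_product finite_permutations finite_PiE finite_lessThan finite.intros)
  then have "countable (J n N)" for n N
    by (rule countable_finite)
  then have "countable I"
    unfolding I_def by (intro countable_SIGMA countable_loc_const countable_UN countableI_type)
  moreover have "{realizing \<phi> n \<sigma> N \<tau> \<pi> | \<phi> n \<sigma> N \<tau> \<pi>. loc_const \<phi> \<and> extension n \<sigma> N \<tau> \<pi>} \<subseteq>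
      (\<lambda>(\<phi>, n, \<sigma>, N, \<tau>, \<pi>). realizing \<phi> n \<sigma> N \<tau> \<pi>) ` I"
  proof
    fix D assume "D \<in> {realizing \<phi> n \<sigma> N \<tau> \<pi> | \<phi> n \<sigma> N \<tau> \<pi>. loc_const \<phi> \<and> extension n \<sigma> N \<tau> \<pi>}"
    then obtain \<phi> n \<sigma> N \<tau> \<pi> where D: "D = realizing \<phi> n \<sigma> N \<tau> \<pi>" "loc_const \<phi>" "extension n \<sigma> N \<tau> \<pi>"
      by blast
    then have "(\<phi>, n, \<sigma>, N, \<tau>, \<pi>) \<in> I"
      by (simp add: I_def J_def extension_def)
    then show "D \<in> (\<lambda>(\<phi>, n, \<sigma>, N, \<tau>, \<pi>). realizing \<phi> n \<sigma> N \<tau> \<pi>) ` I"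
      by (rule rev_image_eqI) (simp add: D(1))
  qed
  ultimately show ?thesis
    unfolding generic_family_def by (meson countable_Un countable_image countable_subset countableI_type)
qed

text \<open>The extension is read off from \<open>f\<close>, which permutes a uniform partition
  finer than \<open>\<phi>\<close>. Being purely combinatorial, it can be demanded of
  \<open>f'\<close> over \<open>\<psi>\<close>.\<close>

lemma generic_extend:
  assumes f: "\<forall>D\<in>generic_family. f \<in> D" and f': "\<forall>D\<in>generic_family. f' \<in> D"
    and \<phi>: "acts f n \<sigma> \<phi>" and \<psi>: "acts f' n \<sigma> \<psi>"
  shows "\<exists>N \<tau> \<phi>' \<psi>' \<pi> s. acts f N \<tau> \<phi>' \<and> acts f' N \<tau> \<psi>' \<and>
    \<phi> = \<pi> \<circ> \<phi>' \<and> \<psi> = \<pi> \<circ> \<psi>' \<and> cyl k = s \<circ> \<phi>'"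
proof -
  have u\<phi>: "uniform n \<phi>" "\<sigma> permutes {..<n}" "\<And>x. \<phi> (f x) = \<sigma> (\<phi> x)"
    using \<phi> by (simp_all add: acts_def)
  obtain j where j: "\<And>x y. cyl j x = cyl j y \<Longrightarrow> \<phi> x = \<phi> y"
    using loc_const_factor[OF acts_loc_const[OF \<phi>]] by blast
  \<comment> \<open>Depth \<open>j\<close> makes the partition refine \<open>\<phi>\<close>, depth
    \<open>k\<close> makes it determine \<open>cyl k\<close>.\<close>
  have "f \<in> periodic_at (max j k)"
    using f by (simp add: generic_family_def)
  then obtain N \<tau> \<rho> r where \<rho>: "acts f N \<tau> \<rho>" "\<forall>x. cyl (max j k) x = r (\<rho> x)"
    unfolding periodic_at_def by blast
  have u\<rho>: "uniform N \<rho>" "\<tau> permutes {..<N}" "\<And>x. \<rho> (f x) = \<tau> (\<rho> x)" "\<And>x. \<rho> x < N"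
    using \<rho>(1) by (simp_all add: acts_def uniform_def)
  have sep: "\<phi> x = \<phi> y" if "\<rho> x = \<rho> y" for x y
  proof (rule j)
    have "cyl (max j k) x = cyl (max j k) y"
      using \<rho>(2) that by simp
    then show "cyl j x = cyl j y"
      by (rule cyl_mono) simp
  qed
  \<comment> \<open>The restriction gives the extensionality that \<open>extension\<close> asks for;
    the choice of point is harmless since \<open>\<phi>\<close> is constant on the cells of
    \<open>\<rho>\<close>.\<close>
  define \<pi> where "\<pi> = (\<lambda>b\<in>{..<N}. \<phi> (SOME x. \<rho> x = b))"
  have \<pi>: "\<pi> (\<rho> x) = \<phi> x" for x
  proof -
    have "\<rho> (SOME y. \<rho> y = \<rho> x) = \<rho> x"
      by (rule someI[where x = x]) simp
    from sep[OF this] show ?thesis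
      by (simp add: \<pi>_def u\<rho>(4))
  qed
  have ext: "extension n \<sigma> N \<tau> \<pi>"
    unfolding extension_def
  proof (intro conjI allI impI)
    show "0 < N" "1 / real N \<in> clopen_values M"
      using uniform_pos uniform_value u\<rho>(1) by blast+
    show "\<sigma> permutes {..<n}" "\<tau> permutes {..<N}"
      by fact+
    have "\<pi> b < n" if b: "b < N" for b
    proof -
      obtain x where "\<rho> x = b"
        using uniform_onto[OF u\<rho>(1) b] by blast
      then show ?thesis
        using \<pi>[of x] u\<phi>(1) by (simp add: uniform_def)
    qed
    then show "\<pi> \<in> {..<N} \<rightarrow>\<^sub>E {..<n}"
      by (auto simp: \<pi>_def)
  next
    fix b assume "b < N"
    then obtain x where x: "\<rho> x = b"
      using uniform_onto[OF u\<rho>(1)] by blast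
    then show "\<pi> (\<tau> b) = \<sigma> (\<pi> b)"
      using \<pi>[of x] \<pi>[of "f x"] u\<rho>(3)[of x] u\<phi>(3)[of x] by simp
  next
    fix a assume a: "a < n"
    \<comment> \<open>The size of the fibre comes from comparing the mass of a cell of
      \<open>\<phi>\<close> with the number of cells of \<open>\<rho>\<close> inside it.\<close>
    have "1 / real n = prob (\<phi> -` {a})"
      using u\<phi>(1) a by (simp add: uniform_def)
    also have "\<phi> -` {a} = \<rho> -` {b. \<pi> b = a}"
      using \<pi> by auto
    also have "prob \<dots> = real (card {b. b < N \<and> \<pi> b = a}) / real N"
      by (simp only: prob_uniform[OF u\<rho>(1)] mem_Collect_eq)
    finally have "real N = real n * real (card {b. b < N \<and> \<pi> b = a})"
      using uniform_pos[OF u\<rho>(1)] uniform_pos[OF u\<phi>(1)] by (simp add: field_simps)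
    then have "real N = real (n * card {b. b < N \<and> \<pi> b = a})"
      by simp
    then show "n * card {b. b < N \<and> \<pi> b = a} = N"
      by (simp only: of_nat_eq_iff)
  qed
  have "f' \<in> realizing \<psi> n \<sigma> N \<tau> \<pi>"
    using f' ext acts_loc_const[OF \<psi>] unfolding generic_family_def by blast
  then obtain \<psi>' where \<psi>': "acts f' N \<tau> \<psi>'" "\<forall>x. \<pi> (\<psi>' x) = \<psi> x"
    unfolding realizing_def using \<psi> by blast
  have "cyl k x = take k (r (\<rho> x))" for x
    using cyl_take[of k "max j k" x] \<rho>(2) by simp
  then have "cyl k = (\<lambda>b. take k (r b)) \<circ> \<rho>" "\<phi> = \<pi> \<circ> \<rho>" "\<psi> = \<pi> \<circ> \<psi>'"
    using \<pi> \<psi>'(2) by (simp_all add: fun_eq_iff)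
  then show ?thesis
    using \<rho>(1) \<psi>'(1) by (intro exI conjI)
qed

text \<open>The invariant of the back and forth is a common finite action. It makes \<open>h\<close>
  intertwine \<open>f\<close> and \<open>f'\<close> up to the labels of each stage, and these
  separate points.\<close>

lemma generic_conjugate:
  assumes H: "f \<in> H" "f' \<in> H"
    and f: "\<forall>D\<in>generic_family. f \<in> D" and f': "\<forall>D\<in>generic_family. f' \<in> D"
  shows "\<exists>h\<in>H. \<forall>x. h (f x) = f' (h x)"
proof -
  define S where "S \<phi> \<psi> \<longleftrightarrow> (\<exists>n \<sigma>. acts f n \<sigma> \<phi> \<and> acts f' n \<sigma> \<psi>)" for \<phi> \<psi>
  have "\<exists>h g \<Phi> \<Psi>. homeomorphism UNIV UNIV h g \<and> (\<forall>k::nat. S (\<Phi> k) (\<Psi> k)) \<and> (\<forall>k. \<Psi> k \<circ> h = \<Phi> k) \<and>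
    \<Phi> 0 = (\<lambda>_. 0) \<and> \<Psi> 0 = (\<lambda>_. 0) \<and> (\<forall>n. \<exists>k s. cyl n = s \<circ> \<Psi> k)"
  proof (rule back_and_forth)
    \<comment> \<open>The one-cell partition starts the construction, since every map acts on it by
      the identity.\<close>
    have "uniform 1 (\<lambda>_. 0)"
      using loc_const_const[of "0 :: nat"] prob_UNIV by (simp add: uniform_def)
    then show "S (\<lambda>_. 0) (\<lambda>_. 0)"
      unfolding S_def acts_def using permutes_id[of "{..<1 :: nat}"]
      by (intro exI[of _ "1 :: nat"] exI[of _ id]) simp
    fix \<phi> \<psi> k assume "S \<phi> \<psi>"
    then obtain n \<sigma> where *: "acts f n \<sigma> \<phi>" "acts f' n \<sigma> \<psi>"
      unfolding S_def by blast
    show "loc_const \<phi> \<and> loc_const \<psi> \<and> range \<phi> = range \<psi>"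
      using uniform_range[of n \<phi>] uniform_range[of n \<psi>] acts_loc_const[OF *(1)] acts_loc_const[OF *(2)] *
      by (simp add: acts_def)
    from generic_extend[OF f f' *, of k] obtain N \<tau> \<phi>' \<psi>' \<pi> s where 1: "acts f N \<tau> \<phi>'" "acts f' N \<tau> \<psi>'"
      "\<phi> = \<pi> \<circ> \<phi>'" "\<psi> = \<pi> \<circ> \<psi>'" "cyl k = s \<circ> \<phi>'"
      by (elim exE conjE)
    have "S \<phi>' \<psi>'"
      unfolding S_def using 1(1,2) by blast
    then show "\<exists>\<phi>' \<psi>' r s. S \<phi>' \<psi>' \<and> \<phi> = r \<circ> \<phi>' \<and> \<psi> = r \<circ> \<psi>' \<and> cyl k = s \<circ> \<phi>'"
      using 1(3-5) by (intro exI conjI)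
    \<comment> \<open>The backward step is the forward step with \<open>f\<close> and
      \<open>f'\<close> exchanged.\<close>
    from generic_extend[OF f' f *(2,1), of k] obtain N \<tau> \<psi>' \<phi>' \<pi> s where 2: "acts f' N \<tau> \<psi>'" "acts f N \<tau> \<phi>'"
      "\<psi> = \<pi> \<circ> \<psi>'" "\<phi> = \<pi> \<circ> \<phi>'" "cyl k = s \<circ> \<psi>'"
      by (elim exE conjE)
    have "S \<phi>' \<psi>'"
      unfolding S_def using 2(1,2) by blast
    then show "\<exists>\<phi>' \<psi>' r s. S \<phi>' \<psi>' \<and> \<phi> = r \<circ> \<phi>' \<and> \<psi> = r \<circ> \<psi>' \<and> cyl k = s \<circ> \<psi>'"
      using 2(3-5) by (intro exI conjI)
  qed
  then obtain h g \<Phi> \<Psi> where h: "homeomorphism UNIV UNIV h g" "\<forall>k::nat. S (\<Phi> k) (\<Psi> k)" "\<forall>k. \<Psi> k \<circ> h = \<Phi> k"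
    "\<forall>n. \<exists>k s. cyl n = s \<circ> \<Psi> k"
    by (elim exE conjE)
  have "h \<in> H"
  proof (rule limit_carrier[OF h(1)])
    show "\<Psi> k \<circ> h = \<Phi> k" for k
      using h(3) ..
    show "\<exists>k s. cyl n = s \<circ> \<Psi> k" for n
      using h(4) ..
    show "prob (\<Phi> k -` A) = prob (\<Psi> k -` A)" for k A
    proof -
      obtain n where "uniform n (\<Phi> k)" "uniform n (\<Psi> k)"
        using h(2)[rule_format, of k] unfolding S_def acts_def by blast
      then show ?thesis
        by (simp only: prob_uniform)
    qed
  qed
  moreover have "h (f x) = f' (h x)" for x
  proof (rule cyl_separates)
    fix n
    from h(4)[rule_format, of n] obtain k s where s: "cyl n = s \<circ> \<Psi> k"
      by (elim exE)
    obtain N \<sigma> where \<sigma>: "\<And>x. \<Phi> k (f x) = \<sigma> (\<Phi> k x)" "\<And>x. \<Psi> k (f' x) = \<sigma> (\<Psi> k x)"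
      using h(2)[rule_format, of k] unfolding S_def acts_def by blast
    have \<Psi>: "\<Psi> k (h y) = \<Phi> k y" for y
      using fun_cong[OF h(3)[rule_format, of k], of y] by simp
    show "cyl n (h (f x)) = cyl n (f' (h x))"
      by (simp add: s \<Psi> \<sigma>)
  qed
  ultimately show ?thesis
    by blast
qed

lemma comeager_class_exists: "\<exists>g\<in>H. comeager_in T (conjugacy_class G g)"
proof (rule comeager_class[OF countable_generic_family])
  fix D assume "D \<in> generic_family"
  then consider k where "D = periodic_at k"
    | \<phi> n \<sigma> N \<tau> \<pi> where "D = realizing \<phi> n \<sigma> N \<tau> \<pi>" "loc_const \<phi>" "extension n \<sigma> N \<tau> \<pi>"
    unfolding generic_family_def by blast
  note D_cases = this
  show "openin T D"
    using D_cases by cases (simp_all add: open_periodic_at open_realizing)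
  show "\<exists>f'\<in>D. \<forall>x. cyl m (f' x) = cyl m (f x)" if "f \<in> H" for f m
    using D_cases by cases (simp_all add: dense_periodic_at dense_realizing that)
qed (rule generic_conjugate)

end

theorem theorem2:
  fixes \<mu> :: "cantor measure"
  assumes "good_measure \<mu>"
    and "clopen_values \<mu> \<subseteq> \<rat>"
  shows "((\<exists>g\<in>carrier (homeo_group \<mu>). dense_in (homeo_topology \<mu>) (conjugacy_class (homeo_group \<mu>) g)) \<longleftrightarrow>
          (\<exists>g\<in>carrier (homeo_group \<mu>). comeager_in (homeo_topology \<mu>) (conjugacy_class (homeo_group \<mu>) g))) \<and>
         ((\<exists>g\<in>carrier (homeo_group \<mu>). comeager_in (homeo_topology \<mu>) (conjugacy_class (homeo_group \<mu>) g)) \<longleftrightarrow>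
          subring (plus_ints (clopen_values \<mu>)) (ring_of_type_algebra :: real ring))"
    (is "(?dense \<longleftrightarrow> ?comeager) \<and> (?comeager \<longleftrightarrow> ?ring)")
proof -
  interpret good_cantor \<mu>
    by (rule good_cantor.intro[OF assms(1)])
  have "?comeager \<Longrightarrow> ?dense"
    using comeager_imp_dense by blast
  moreover have "?dense \<Longrightarrow> ?ring"
    using dense_class_imp_subring[OF assms(2)] by blast
  moreover have "?ring \<Longrightarrow> ?comeager"
  proof -
    assume "?ring"
    then interpret rational_ring_cantor \<mu>
      using assms(2) by unfold_locales (simp_all add: subring_iff)
    show ?comeager
      by (rule comeager_class_exists)
  qed
  ultimately show ?thesis
    by blast
qed

end
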